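(* For every $n\ge 1$, the degree-$n$ part $G_n$ (in $\mathsf{x}$) of the generating function of labeled plane binary trees by left ascents, left descents, right ascents and right descents satisfies $$G_n=\sum_{\substack{\pi\in\mathrm{mNC}(n)\\ \pi=B_1/\cdots/B_k}}\mathrm{wt}(\pi)\,r_{c(B_1)}r_{c(B_2)}\cdots r_{c(B_k)},$$ where the sum is over all marked interlacing partitions $\pi$ of $[n]$, with blocks $B_1,\dots,B_k$.
   Context: **Trees.** A (plane binary) tree is a rooted tree in which every node has at most one left child and at most one right child (it may have only one of the two), and no other children. A labeled tree is a tree whose nodes are labeled with positive integers, repetitions allowed; $\mathcal{T}^{\ell}_n$ is the set of labeled trees on $n$ nodes. Write $v^\ell$ for the label of $v$. If $v$ is the left child of $w$, the edge is a left ascent if $v^\ell\le w^\ell$ and a left descent otherwise. If $w$ is the right child of $v$, the edge is a right ascent if $v^\ell\le w^\ell$ and a right descent otherwise. $\mathrm{lasc},\mathrm{ldes},\mathrm{rasc},\mathrm{rdes}$ count these edges. With commuting indeterminates $\mathsf{x}=\{x_1,x_2,\dots\}$ and $\bar\lambda,\lambda,\bar\rho,\rho$, and $\mathsf{x}^T=\prod_{v\in T}x_{v^\ell}$, $$G_n=\sum_{T\in\mathcal{T}^\ell_n}\bar\lambda^{\mathrm{lasc}(T)}\lambda^{\mathrm{ldes}(T)}\bar\rho^{\,\mathrm{rasc}(T)}\rho^{\,\mathrm{rdes}(T)}\,\mathsf{x}^T.$$ **Ribbon Schur functions.** For a composition $\alpha=(\alpha_1,\dots,\alpha_k)\vDash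 n$ let $\mathrm{set}(\alpha)=\{\alpha_1,\alpha_1+\alpha_2,\dots,\alpha_1+\cdots+\alpha_{k-1}\}$, and $r_\alpha=\sum_w x_{w_1}\cdots x_{w_n}$ over words $w$ of $n$ positive integers with $\{i:w_i>w_{i+1}\}=\mathrm{set}(\alpha)$. **Marked interlacing partitions.** A set partition $\pi$ of $[n]$ is noncrossing if there are no $a<b<c<d$ with $a,c$ in one block and $b,d$ in a different block. Write $\pi=B_1/\cdots/B_k$ with blocks in increasing order of minima. Let $\max(\pi)$ and $\min(\pi)$ be the sets of maxima and of minima of the blocks. A noncrossing partition $\pi$ is interlacing if $i\in\max(\pi)$ implies $i+1\notin\min(\pi)$ for all $i$. For $i\notin\max(\pi)$, let $j$ be the next larger element of the block of $i$; $i$ is a stepper if $j=i+1$ and a jumper if $j\ge i+2$. A marked interlacing partition is an interlacing noncrossing partition together with a choice of a subset of $[n]\setminus\max(\pi)$ of marked elements; $\mathrm{mNC}(n)$ is the set of all these. For a block $B$, listed increasingly, split $B$ into consecutive pieces by breaking after each marked element; $c(B)$ is the composition of $|B|$ given by the sizes of the pieces in order. Define $$\mathrm{wt}(\pi)=(\bar\lambda+\bar\rho)^{\mathrm{sa}(\pi)}(\lambda+\rho)^{\mathrm{sd}(\pi)}(\bar\lambda\bar\rho)^{\mathrm{ja}(\pi)}(\lambda\rho)^{\mathrm{jd}(\pi)},$$ where $\mathrm{sa},\mathrm{sd},\mathrm{ja},\mathrm{jd}$ are the numbers of unmarked steppers, marked steppers, unmarked jumpers, and marked jumpers of $\pi$.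 *)

theory Defs
  imports
    "HOL-Library.Tree"
    "HOL-Library.Multiset"
    "HOL-Library.Poly_Mapping"
    "HOL-Library.Disjoint_Sets"
begin

section \<open>Formal power series in arbitrarily many variables\<close>

text \<open>
  A monomial in the variables \<open>x\<^sub>v\<close> is the multiset of the indices \<open>v\<close> of its factors, so that
  the product of monomials is multiset union. A formal power series is an arbitrary function
  from monomials to coefficients. Infinitely many monomials of the same degree may occur, so
  finitely supported mappings would not suffice.
\<close>

typedef ('v, 'c) mfps = "UNIV :: ('v multiset \<Rightarrow> 'c) set"
  morphisms mcoeff Abs_mfps ..

setup_lifting type_definition_mfps

lemma mfps_eqI: "(\<And>m. mcoeff f m = mcoeff g m) \<Longrightarrow> f = g"
  by transfer auto

lemma finite_subeq_mset: "finite {A. A \<subseteq># (M :: 'v multiset)}"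
proof (induction M)
  case (add x M)
  have "{A. A \<subseteq># add_mset x M} \<subseteq> {A. A \<subseteq># M} \<union> add_mset x ` {A. A \<subseteq># M}"
  proof
    fix A assume "A \<in> {A. A \<subseteq># add_mset x M}"
    then have A: "A \<subseteq># add_mset x M" by simp
    show "A \<in> {A. A \<subseteq># M} \<union> add_mset x ` {A. A \<subseteq># M}"
    proof (cases "x \<in># A")
      case True
      then obtain B where "A = add_mset x B" by (metis insert_DiffM)
      with A show ?thesis by auto
    next
      case False
      with A show ?thesis
        by (metis CollectI UnI1 diff_single_trivial subset_eq_diff_conv add_mset_add_single)
    qed
  qed
  with add show ?case by (meson finite_UnI finite_imageI finite_subset)
qed simp

lemma finite_mset_splits: "finite {(A, B). A + B = (M :: 'v multiset)}"
proof -
  have "{(A, B). A + B = M} \<subseteq> {A. A \<subseteq># M} \<times> {A. A \<subseteq># M}" by auto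
  then show ?thesis using finite_subeq_mset finite_subset by blast
qed

lemma finite_mset_splits': "finite {p. fst p + snd p = (M :: 'v multiset)}"
  using finite_mset_splits[of M] by (simp add: case_prod_beta')

instantiation mfps :: (type, comm_ring_1) comm_ring_1
begin

lift_definition zero_mfps :: "('a, 'b) mfps" is "\<lambda>_. 0" .
lift_definition one_mfps :: "('a, 'b) mfps" is "\<lambda>m. if m = {#} then 1 else 0" .
lift_definition plus_mfps :: "('a, 'b) mfps \<Rightarrow> ('a, 'b) mfps \<Rightarrow> ('a, 'b) mfps"
  is "\<lambda>f g m. f m + g m" .
lift_definition minus_mfps :: "('a, 'b) mfps \<Rightarrow> ('a, 'b) mfps \<Rightarrow> ('a, 'b) mfps"
  is "\<lambda>f g m. f m - g m" .
lift_definition uminus_mfps :: "('a, 'b) mfps \<Rightarrow> ('a, 'b) mfps"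
  is "\<lambda>f m. - f m" .
lift_definition times_mfps :: "('a, 'b) mfps \<Rightarrow> ('a, 'b) mfps \<Rightarrow> ('a, 'b) mfps"
  is "\<lambda>f g m. \<Sum>(a, b) | a + b = m. f a * g b" .

instance
proof
  fix f g h :: "('a, 'b) mfps"
  show "f * g * h = f * (g * h)"
  proof (rule mfps_eqI)
    fix m
    let ?S = "\<lambda>m :: 'a multiset. {(a, b). a + b = m}"
    let ?F = "mcoeff f" and ?G = "mcoeff g" and ?H = "mcoeff h"
    have "mcoeff (f * g * h) m
        = (\<Sum>p\<in>?S m. \<Sum>q\<in>?S (fst p). ?F (fst q) * ?G (snd q) * ?H (snd p))"
      by (simp add: times_mfps.rep_eq sum_distrib_right case_prod_beta)
    also have "\<dots> = (\<Sum>(p, q)\<in>Sigma (?S m) (\<lambda>p. ?S (fst p)).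
        ?F (fst q) * ?G (snd q) * ?H (snd p))"
      by (rule sum.Sigma) (auto intro: finite_mset_splits)
    also have "\<dots> = (\<Sum>(p, q)\<in>Sigma (?S m) (\<lambda>p. ?S (snd p)).
        ?F (fst p) * (?G (fst q) * ?H (snd q)))"
      by (rule sum.reindex_bij_witness
            [where i = "\<lambda>((a, d), (b, c)). ((a + b, c), (a, b))"
               and j = "\<lambda>((d, c), (a, b)). ((a, b + c), (b, c))"])
         (auto simp: add.assoc mult.assoc)
    also have "\<dots> = (\<Sum>p\<in>?S m. \<Sum>q\<in>?S (snd p). ?F (fst p) * (?G (fst q) * ?H (snd q)))"
      by (rule sum.Sigma[symmetric]) (auto intro: finite_mset_splits)
    also have "\<dots> = mcoeff (f * (g * h)) m"
      by (simp add: times_mfps.rep_eq sum_distrib_left case_prod_beta)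
    finally show "mcoeff (f * g * h) m = mcoeff (f * (g * h)) m" .
  qed
  show "f * g = g * f"
  proof (rule mfps_eqI)
    fix m
    show "mcoeff (f * g) m = mcoeff (g * f) m"
      unfolding times_mfps.rep_eq
      by (rule sum.reindex_bij_witness[where i = prod.swap and j = prod.swap])
         (auto simp: add.commute mult.commute)
  qed
  show "1 * f = f"
  proof (rule mfps_eqI)
    fix m
    have "mcoeff (1 * f) m
        = (\<Sum>p | fst p + snd p = m. if p = ({#}, m) then mcoeff f m else 0)"
      unfolding times_mfps.rep_eq one_mfps.rep_eq
      by (intro sum.cong) (auto split: if_splits)
    also have "\<dots> = mcoeff f m"
      by (subst sum.delta[OF finite_mset_splits']) simp
    finally show "mcoeff (1 * f) m = mcoeff f m" .
  qed
  show "(f + g) * h = f * h + g * h"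
    by (rule mfps_eqI)
       (simp add: times_mfps.rep_eq plus_mfps.rep_eq sum.distrib distrib_right case_prod_beta)
  show "(0 :: ('a, 'b) mfps) \<noteq> 1"
    by transfer (metis zero_neq_one)
qed (transfer; auto simp: algebra_simps)+

end

lift_definition mconst :: "'c \<Rightarrow> ('v, 'c :: zero) mfps"
  is "\<lambda>c m. if m = {#} then c else 0" .

lift_definition mvar :: "'v \<Rightarrow> ('v, 'c :: zero_neq_one) mfps"
  is "\<lambda>v m. if m = {#v#} then 1 else 0" .

text \<open>
  The formal sum of a possibly infinite family, taken coefficient by coefficient. It is meaningful
  for summable families, in which every monomial occurs in only finitely many members.
\<close>

definition msummable :: "('i \<Rightarrow> ('v, 'c :: comm_monoid_add) mfps) \<Rightarrow> 'i set \<Rightarrow> bool" where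
  "msummable f I \<longleftrightarrow> (\<forall>m. finite {i \<in> I. mcoeff (f i) m \<noteq> 0})"

lift_definition msum :: "('i \<Rightarrow> ('v, 'c :: comm_monoid_add) mfps) \<Rightarrow> 'i set \<Rightarrow> ('v, 'c) mfps"
  is "\<lambda>f I m. \<Sum>i | i \<in> I \<and> f i m \<noteq> 0. f i m" .

lemma mcoeff_mconst_times: "mcoeff (mconst c * f) m = c * mcoeff f m"
proof -
  have "mcoeff (mconst c * f) m
      = (\<Sum>p | fst p + snd p = m. if p = ({#}, m) then c * mcoeff f m else 0)"
    unfolding times_mfps.rep_eq mconst.rep_eq
    by (intro sum.cong) (auto split: if_splits)
  also have "\<dots> = c * mcoeff f m"
    by (subst sum.delta[OF finite_mset_splits']) simp
  finally show ?thesis .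
qed

lemma mcoeff_mvar_times:
  "mcoeff (mvar v * f) m = (if v \<in># m then mcoeff f (m - {#v#}) else 0)"
proof -
  have "mcoeff (mvar v * f) m
      = (\<Sum>p | fst p + snd p = m.
          if p = ({#v#}, m - {#v#}) then mcoeff f (m - {#v#}) else 0)"
    unfolding times_mfps.rep_eq mvar.rep_eq
    by (intro sum.cong) (auto split: if_splits)
  also have "\<dots> = (if v \<in># m then mcoeff f (m - {#v#}) else 0)"
    by (subst sum.delta[OF finite_mset_splits']) (auto simp: subset_mset.le_imp_diff_is_add)
  finally show ?thesis .
qed

lemma mcoeff_prod_list_mvar:
  "mcoeff (prod_list (map mvar vs)) m = (if m = mset vs then 1 else 0)"
proof (induction vs arbitrary: m)
  case Nil
  then show ?case by (simp add: one_mfps.rep_eq)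
next
  case (Cons v vs)
  then show ?case by (auto simp: mcoeff_mvar_times dest: insert_DiffM)
qed


section \<open>The coefficient ring\<close>

datatype edge_kind = LAsc | LDes | RAsc | RDes

text \<open>
  Integer polynomials in four indeterminates, indexed by the four kinds of edges. As above,
  a monomial is the multiset of its factors.
\<close>

type_synonym edge_poly = "edge_kind multiset \<Rightarrow>\<^sub>0 int"

definition edge_var :: "edge_kind \<Rightarrow> edge_poly" where
  "edge_var k = Poly_Mapping.single {#k#} 1"

abbreviation lam_bar :: edge_poly where "lam_bar \<equiv> edge_var LAsc"
abbreviation lam :: edge_poly where "lam \<equiv> edge_var LDes"
abbreviation rho_bar :: edge_poly where "rho_bar \<equiv> edge_var RAsc"
abbreviation rho :: edge_poly where "rho \<equiv> edge_var RDes"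

type_synonym series = "(nat, edge_poly) mfps"


section \<open>Labeled plane binary trees\<close>

text \<open>
  In the type \<open>nat tree\<close> the nodes are the \<open>Node\<close>s; \<open>Leaf\<close> is the empty tree and marks an absent
  child.
\<close>

definition labeled_trees :: "nat \<Rightarrow> nat tree set" where
  "labeled_trees n = {t. size t = n \<and> (\<forall>a \<in> set_tree t. a > 0)}"

text \<open>
  \<open>left_edges t\<close> and \<open>right_edges t\<close> list the edges of \<open>t\<close> to a left and to a right child, each as
  the pair of the label of the parent and the label of the child.
\<close>

fun left_edges :: "nat tree \<Rightarrow> (nat \<times> nat) list" where
  "left_edges Leaf = []"
| "left_edges (Node l a r) =
     (case l of Leaf \<Rightarrow> [] | Node _ b _ \<Rightarrow> [(a, b)]) @ left_edges l @ left_edges r"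

fun right_edges :: "nat tree \<Rightarrow> (nat \<times> nat) list" where
  "right_edges Leaf = []"
| "right_edges (Node l a r) =
     (case r of Leaf \<Rightarrow> [] | Node _ b _ \<Rightarrow> [(a, b)]) @ right_edges l @ right_edges r"

text \<open>
  Edges are compared from left to right: along a left edge the child comes first, along a right
  edge the parent does.
\<close>

definition lasc :: "nat tree \<Rightarrow> nat" where
  "lasc t = length (filter (\<lambda>(p, c). c \<le> p) (left_edges t))"
definition ldes :: "nat tree \<Rightarrow> nat" where
  "ldes t = length (filter (\<lambda>(p, c). c > p) (left_edges t))"
definition rasc :: "nat tree \<Rightarrow> nat" where
  "rasc t = length (filter (\<lambda>(p, c). p \<le> c) (right_edges t))"
definition rdes :: "nat tree \<Rightarrow> nat" where
  "rdes t = length (filter (\<lambda>(p, c). p > c) (right_edges t))"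

definition tree_term :: "nat tree \<Rightarrow> series" where
  "tree_term t =
     mconst (lam_bar ^ lasc t * lam ^ ldes t * rho_bar ^ rasc t * rho ^ rdes t)
     * prod_list (map mvar (inorder t))"

definition G :: "nat \<Rightarrow> series" where
  "G n = msum tree_term (labeled_trees n)"

lemma finite_trees_of_size:
  assumes "finite A"
  shows "finite {t. size t = n \<and> set_tree t \<subseteq> A}"
proof (induction n rule: less_induct)
  case (less n)
  let ?S = "\<lambda>n. {t. size t = n \<and> set_tree t \<subseteq> A}"
  let ?U = "\<Union>k<n. ?S k"
  have "?S n \<subseteq> insert Leaf ((\<lambda>(l, a, r). Node l a r) ` (?U \<times> A \<times> ?U))"
  proof
    fix t assume t: "t \<in> ?S n"
    show "t \<in> insert Leaf ((\<lambda>(l, a, r). Node l a r) ` (?U \<times> A \<times> ?U))"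
    proof (cases t)
      case (Node l a r)
      with t have "l \<in> ?U" "a \<in> A" "r \<in> ?U" by auto
      then have "(l, a, r) \<in> ?U \<times> A \<times> ?U" by simp
      then show ?thesis unfolding Node by (intro insertI2 image_eqI[where x = "(l, a, r)"]) auto
    qed simp
  qed
  moreover have "finite ?U" using less by auto
  ultimately show ?case using assms
    by (meson finite_SigmaI finite_imageI finite_insert finite_subset)
qed

lemma msummable_G: "msummable tree_term (labeled_trees n)"
  unfolding msummable_def
proof
  fix m
  have "{t \<in> labeled_trees n. mcoeff (tree_term t) m \<noteq> 0}
      \<subseteq> {t. size t = n \<and> set_tree t \<subseteq> set_mset m}"
  proof
    fix t assume t: "t \<in> {t \<in> labeled_trees n. mcoeff (tree_term t) m \<noteq> 0}"
    then have "m = mset (inorder t)"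
      by (auto simp: tree_term_def mcoeff_mconst_times mcoeff_prod_list_mvar split: if_splits)
    then show "t \<in> {t. size t = n \<and> set_tree t \<subseteq> set_mset m}"
      using t by (auto simp: labeled_trees_def)
  qed
  then show "finite {t \<in> labeled_trees n. mcoeff (tree_term t) m \<noteq> 0}"
    using finite_trees_of_size[of "set_mset m" n] finite_subset by blast
qed


section \<open>Ribbon Schur functions\<close>

definition comp_set :: "nat list \<Rightarrow> nat set" where
  "comp_set \<alpha> = {sum_list (take j \<alpha>) | j. 1 \<le> j \<and> j < length \<alpha>}"

text \<open>Lists are indexed from 0, so the \<open>i\<close>-th letter of a word \<open>w\<close> is \<open>w ! (i - 1)\<close>.\<close>

definition word_descents :: "nat list \<Rightarrow> nat set" where
  "word_descents w = {i. 1 \<le> i \<and> i < length w \<and> w ! (i - 1) > w ! i}"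

definition ribbon_words :: "nat list \<Rightarrow> nat list set" where
  "ribbon_words \<alpha> =
     {w. length w = sum_list \<alpha> \<and> (\<forall>a \<in> set w. a > 0) \<and> word_descents w = comp_set \<alpha>}"

definition ribbon :: "nat list \<Rightarrow> series" where
  "ribbon \<alpha> = msum (\<lambda>w. prod_list (map mvar w)) (ribbon_words \<alpha>)"

lemma msummable_ribbon:
  "msummable (\<lambda>w. prod_list (map mvar w) :: series) (ribbon_words \<alpha>)"
  unfolding msummable_def
proof
  fix m
  have "{w \<in> ribbon_words \<alpha>. mcoeff (prod_list (map mvar w) :: series) m \<noteq> 0}
      \<subseteq> {w. set w \<subseteq> set_mset m \<and> length w = sum_list \<alpha>}"
    by (auto simp: ribbon_words_def mcoeff_prod_list_mvar split: if_splits)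
  then show "finite {w \<in> ribbon_words \<alpha>. mcoeff (prod_list (map mvar w) :: series) m \<noteq> 0}"
    using finite_lists_length_eq[of "set_mset m" "sum_list \<alpha>"] finite_subset by blast
qed


section \<open>Marked interlacing partitions\<close>

definition noncrossing :: "nat set set \<Rightarrow> bool" where
  "noncrossing P \<longleftrightarrow>
     \<not> (\<exists>B\<in>P. \<exists>C\<in>P. B \<noteq> C \<and>
          (\<exists>a b c d. a < b \<and> b < c \<and> c < d \<and> a \<in> B \<and> c \<in> B \<and> b \<in> C \<and> d \<in> C))"

definition maxima :: "nat set set \<Rightarrow> nat set" where
  "maxima P = Max ` P"

definition minima :: "nat set set \<Rightarrow> nat set" where
  "minima P = Min ` P"

definition interlacing :: "nat set set \<Rightarrow> bool" where
  "interlacing P \<longleftrightarrow> noncrossing P \<and> (\<forall>i. i \<in> maxima P \<longrightarrow> i + 1 \<notin> minima P)"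

text \<open>A marked interlacing partition is a pair of the set of its blocks and the set of its marked
  elements.\<close>

type_synonym marked_partition = "nat set set \<times> nat set"

definition mNC :: "nat \<Rightarrow> marked_partition set" where
  "mNC n = {(P, M). partition_on {1..n} P \<and> interlacing P \<and> M \<subseteq> {1..n} - maxima P}"

lemma finite_mNC: "finite (mNC n)"
proof -
  have "mNC n \<subseteq> Pow (Pow {1..n}) \<times> Pow {1..n}"
    by (auto simp: mNC_def partition_on_def)
  then show ?thesis by (rule finite_subset) simp
qed

text \<open>\<open>next_in P i\<close> is the next larger element of the block of \<open>i\<close>, provided that \<open>i\<close> is not the
  maximum of its block.\<close>

definition next_in :: "nat set set \<Rightarrow> nat \<Rightarrow> nat" where
  "next_in P i = Min {j. j > i \<and> (\<exists>B\<in>P. i \<in> B \<and> j \<in> B)}"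

definition steppers :: "nat set set \<Rightarrow> nat set" where
  "steppers P = {i \<in> \<Union>P - maxima P. next_in P i = i + 1}"

definition jumpers :: "nat set set \<Rightarrow> nat set" where
  "jumpers P = {i \<in> \<Union>P - maxima P. next_in P i \<ge> i + 2}"

text \<open>Unmarked steppers and jumpers are counted by \<open>sa\<close> and \<open>ja\<close>, marked ones by \<open>sd\<close> and \<open>jd\<close>.\<close>

definition sa :: "marked_partition \<Rightarrow> nat" where
  "sa = (\<lambda>(P, M). card (steppers P - M))"
definition sd :: "marked_partition \<Rightarrow> nat" where
  "sd = (\<lambda>(P, M). card (steppers P \<inter> M))"
definition ja :: "marked_partition \<Rightarrow> nat" where
  "ja = (\<lambda>(P, M). card (jumpers P - M))"
definition jd :: "marked_partition \<Rightarrow> nat" where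
  "jd = (\<lambda>(P, M). card (jumpers P \<inter> M))"

definition wt :: "marked_partition \<Rightarrow> edge_poly" where
  "wt \<pi> = (lam_bar + rho_bar) ^ sa \<pi> * (lam + rho) ^ sd \<pi>
          * (lam_bar * rho_bar) ^ ja \<pi> * (lam * rho) ^ jd \<pi>"

text \<open>Breaking a list after each element of \<open>M\<close>.\<close>

fun pieces :: "nat set \<Rightarrow> nat list \<Rightarrow> nat list list" where
  "pieces M [] = []"
| "pieces M (x # xs) =
     (case pieces M xs of
        [] \<Rightarrow> [[x]]
      | p # ps \<Rightarrow> if x \<in> M then [x] # p # ps else (x # p) # ps)"

definition block_comp :: "nat set \<Rightarrow> nat set \<Rightarrow> nat list" where
  "block_comp M B = map length (pieces M (sorted_list_of_set B))"

end

theory Submission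
  imports Defs
begin

text \<open>
  Let \<open>G\<close> be the sum of all \<open>G n\<close> with \<open>n \<ge> 1\<close>, and \<open>S\<^sub>v\<close> its part coming from trees with root
  label at most \<open>v\<close>. Removing the root gives a quadratic recursion for \<open>S\<^sub>v\<close>, and
  \<open>V\<^sub>v = (1 + \<lambda>' G) S\<^sub>v / (1 + \<lambda> G + (\<lambda>' - \<lambda>) S\<^sub>v)\<close> (primes for bars) linearises it: \<open>V\<^sub>v\<close> satisfies
  the recursion of the generating function of words with first letter at most \<open>v\<close>, in which an
  ascent has weight \<open>\<lambda>' + \<rho>' + \<lambda>' \<rho>' G\<close> and a descent has weight \<open>\<lambda> + \<rho> + \<lambda> \<rho> G\<close>. As \<open>S\<^sub>v\<close> and
  \<open>V\<^sub>v\<close> have the same limit \<open>G\<close>, this is a fixed-point equation determining \<open>G\<close>.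

  In an interlacing partition, the block of 1 also contains the largest element, and the gap
  between two consecutive elements of this block is empty (a stepper) or carries an interlacing
  partition (a jumper).
  Hence the sum over marked interlacing partitions satisfies the same equation, the letters of the
  ribbon words being placed on the elements of the blocks and the marks recording their descents.
\<close>

section \<open>Series indexed by families with finite fibres\<close>

text \<open>Each index contributes one term, the monomial \<open>\<mu> i\<close> with coefficient
  \<open>c i\<close>. A sum over an infinite fibre of \<open>\<mu>\<close> is 0 by convention, which
  is why additivity and products below assume \<open>finite_fibres\<close>.\<close>

lift_definition gser :: "('i \<Rightarrow> 'c) \<Rightarrow> ('i \<Rightarrow> 'v multiset) \<Rightarrow> 'i set \<Rightarrow> ('v, 'c :: comm_monoid_add) mfps"
  is "\<lambda>c \<mu> I m. \<Sum>i | i \<in> I \<and> \<mu> i = m. c i" .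

definition finite_fibres :: "('i \<Rightarrow> 'b) \<Rightarrow> 'i set \<Rightarrow> bool" where
  "finite_fibres \<mu> I \<longleftrightarrow> (\<forall>m. finite {i. i \<in> I \<and> \<mu> i = m})"

lemma finite_fibres_subset: "finite_fibres \<mu> I \<Longrightarrow> J \<subseteq> I \<Longrightarrow> finite_fibres \<mu> J"
  unfolding finite_fibres_def by (auto elim!: finite_subset[rotated])

text \<open>The products of a fibre over \<open>a\<close> with a fibre over \<open>b\<close>, where
  \<open>a + b = m\<close>, partition the fibre of \<open>I \<times> J\<close> over
  \<open>m\<close>.\<close>

lemma gser_times:
  fixes c d :: "_ \<Rightarrow> 'c :: comm_ring_1"
  assumes "finite_fibres \<mu> I" "finite_fibres \<nu> J"
  shows "gser c \<mu> I * gser d \<nu> J = gser (\<lambda>(i, j). c i * d j) (\<lambda>(i, j). \<mu> i + \<nu> j) (I \<times> J)"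
proof (rule mfps_eqI)
  fix m
  let ?X = "\<lambda>(a, b). {i. i \<in> I \<and> \<mu> i = a} \<times> {j. j \<in> J \<and> \<nu> j = b}"
  have fin: "finite (?X p)" for p using assms by (auto simp: finite_fibres_def case_prod_beta)
  have "mcoeff (gser c \<mu> I * gser d \<nu> J) m
      = (\<Sum>(a, b) | a + b = m. \<Sum>(i, j)\<in>?X (a, b). c i * d j)"
    by (simp add: times_mfps.rep_eq gser.rep_eq sum_product sum.cartesian_product)
  also have "\<dots> = (\<Sum>p | fst p + snd p = m. \<Sum>(i, j)\<in>?X p. c i * d j)"
    by (simp add: case_prod_beta')
  also have "\<dots> = (\<Sum>(i, j)\<in>(\<Union>p\<in>{p. fst p + snd p = m}. ?X p). c i * d j)"
    by (rule sum.UNION_disjoint[symmetric]) (use fin finite_mset_splits' in auto)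
  also have "\<dots> = mcoeff (gser (\<lambda>(i, j). c i * d j) (\<lambda>(i, j). \<mu> i + \<nu> j) (I \<times> J)) m"
    unfolding gser.rep_eq by (rule sum.cong) auto
  finally show "mcoeff (gser c \<mu> I * gser d \<nu> J) m =
      mcoeff (gser (\<lambda>(i, j). c i * d j) (\<lambda>(i, j). \<mu> i + \<nu> j) (I \<times> J)) m" .
qed

lemma gser_Un:
  assumes "finite_fibres \<mu> (I \<union> J)" "I \<inter> J = {}"
  shows "gser c \<mu> (I \<union> J) = gser c \<mu> I + gser c \<mu> J"
proof (rule mfps_eqI)
  fix m
  have "{i. i \<in> I \<union> J \<and> \<mu> i = m} = {i. i \<in> I \<and> \<mu> i = m} \<union> {i. i \<in> J \<and> \<mu> i = m}" by auto
  moreover have "finite {i. i \<in> I \<and> \<mu> i = m}" "finite {i. i \<in> J \<and> \<mu> i = m}"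
    using finite_fibres_subset[OF assms(1)] by (auto simp: finite_fibres_def)
  ultimately show "mcoeff (gser c \<mu> (I \<union> J)) m = mcoeff (gser c \<mu> I + gser c \<mu> J) m"
    using assms(2) by (simp add: gser.rep_eq plus_mfps.rep_eq) (subst sum.union_disjoint, auto)
qed

lemma mcoeff_sum: "mcoeff (\<Sum>k\<in>K. f k) m = (\<Sum>k\<in>K. mcoeff (f k) m)"
  by (induction K rule: infinite_finite_induct) (auto simp: zero_mfps.rep_eq plus_mfps.rep_eq)

lemma gser_UN:
  fixes c :: "'i \<Rightarrow> 'c :: comm_ring_1"
  assumes "finite K" "\<And>k. k \<in> K \<Longrightarrow> finite_fibres \<mu> (I k)"
    and "\<And>k l. k \<in> K \<Longrightarrow> l \<in> K \<Longrightarrow> k \<noteq> l \<Longrightarrow> I k \<inter> I l = {}"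
  shows "gser c \<mu> (\<Union>k\<in>K. I k) = (\<Sum>k\<in>K. gser c \<mu> (I k))"
proof (rule mfps_eqI)
  fix m
  have eq: "{i. i \<in> (\<Union>k\<in>K. I k) \<and> \<mu> i = m} = (\<Union>k\<in>K. {i. i \<in> I k \<and> \<mu> i = m})" by auto
  show "mcoeff (gser c \<mu> (\<Union>k\<in>K. I k)) m = mcoeff (\<Sum>k\<in>K. gser c \<mu> (I k)) m"
    unfolding mcoeff_sum gser.rep_eq eq
    by (rule sum.UNION_disjoint) (use assms in \<open>auto simp: finite_fibres_def, blast\<close>)
qed

lemma gser_reindex: "inj_on f I \<Longrightarrow> gser c \<mu> (f ` I) = gser (c \<circ> f) (\<mu> \<circ> f) I"
proof (rule mfps_eqI)
  fix m assume inj: "inj_on f I"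
  have eq: "{i. i \<in> f ` I \<and> \<mu> i = m} = f ` {i. i \<in> I \<and> \<mu> (f i) = m}" by auto
  have "inj_on f {i. i \<in> I \<and> \<mu> (f i) = m}" using inj by (rule inj_on_subset) auto
  then show "mcoeff (gser c \<mu> (f ` I)) m = mcoeff (gser (c \<circ> f) (\<mu> \<circ> f) I) m"
    unfolding gser.rep_eq eq by (simp add: sum.reindex)
qed

lemma gser_cong:
  "I = J \<Longrightarrow> (\<And>i. i \<in> J \<Longrightarrow> c i = d i) \<Longrightarrow> (\<And>i. i \<in> J \<Longrightarrow> \<mu> i = \<nu> i) \<Longrightarrow>
    gser c \<mu> I = gser d \<nu> J"
  by (rule mfps_eqI) (auto simp: gser.rep_eq intro!: sum.cong)

lemma gser_cmult:
  "gser (\<lambda>i. k * c i) \<mu> I = mconst k * gser c \<mu> I" for k :: "'c :: comm_ring_1"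
  by (rule mfps_eqI) (simp add: gser.rep_eq mcoeff_mconst_times sum_distrib_left)

lemma gser_empty [simp]: "gser c \<mu> {} = 0"
  by (rule mfps_eqI) (simp add: gser.rep_eq zero_mfps.rep_eq)

lemma gser_one: "\<mu> i = {#} \<Longrightarrow> c i = 1 \<Longrightarrow> gser c \<mu> {i} = (1 :: ('v, 'c :: comm_ring_1) mfps)"
  by (rule mfps_eqI) (auto simp: gser.rep_eq one_mfps.rep_eq conj_commute cong: conj_cong)

lemma mvar_times_gser: "gser c (\<lambda>i. add_mset v (\<mu> i)) I = mvar v * gser c \<mu> I"
  for c :: "'i \<Rightarrow> 'c :: comm_ring_1"
proof (rule mfps_eqI)
  fix m
  show "mcoeff (gser c (\<lambda>i. add_mset v (\<mu> i)) I) m = mcoeff (mvar v * gser c \<mu> I) m"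
  proof (cases "v \<in># m")
    case True
    then obtain m' where "m = add_mset v m'" by (metis insert_DiffM)
    then show ?thesis by (simp add: gser.rep_eq mcoeff_mvar_times)
  next
    case False
    then have eq: "{i. i \<in> I \<and> add_mset v (\<mu> i) = m} = {}" by auto
    show ?thesis using False unfolding gser.rep_eq eq by (simp add: mcoeff_mvar_times)
  qed
qed

lemma msum_eq_gser:
  fixes c :: "'i \<Rightarrow> 'c :: comm_ring_1"
  assumes "\<And>i m. i \<in> I \<Longrightarrow> mcoeff (f i) m = (if m = \<mu> i then c i else 0)"
    and "finite_fibres \<mu> I"
  shows "msum f I = gser c \<mu> I"
proof (rule mfps_eqI)
  fix m
  have eq: "{i. i \<in> I \<and> mcoeff (f i) m \<noteq> 0} = {i \<in> {i. i \<in> I \<and> \<mu> i = m}. c i \<noteq> 0}"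
    using assms(1) by (auto split: if_splits)
  have "finite {i. i \<in> I \<and> \<mu> i = m}" using assms(2) by (simp add: finite_fibres_def)
  then show "mcoeff (msum f I) m = mcoeff (gser c \<mu> I) m"
    unfolding msum.rep_eq gser.rep_eq eq
    by (intro sum.mono_neutral_cong_left) (auto simp: assms(1))
qed

section \<open>Agreement of series on sets of monomials\<close>

text \<open>Equality modulo the monomials outside \<open>D\<close>. Two kinds of \<open>D\<close>
  are used: monomials in variables of index at most \<open>v\<close>, which stand in for a limit in
  \<open>v\<close>, and monomials of degree less than \<open>k\<close>, for the uniqueness of a
  fixed point.\<close>

definition agree :: "'v multiset set \<Rightarrow> ('v, 'c) mfps \<Rightarrow> ('v, 'c) mfps \<Rightarrow> bool" where
  "agree D f g \<longleftrightarrow> (\<forall>m\<in>D. mcoeff f m = mcoeff g m)"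

text \<open>For monomials this is closure under divisors: coefficients of a product on
  \<open>D\<close> then involve only coefficients of the factors on \<open>D\<close>, so agreement
  is compatible with multiplication.\<close>

definition down_closed :: "'v multiset set \<Rightarrow> bool" where
  "down_closed D \<longleftrightarrow> (\<forall>a b. a + b \<in> D \<longrightarrow> a \<in> D \<and> b \<in> D)"

lemma agree_refl [simp, intro]: "agree D f f"
  and agree_sym: "agree D f g \<Longrightarrow> agree D g f"
  and agree_trans: "agree D f g \<Longrightarrow> agree D g h \<Longrightarrow> agree D f h"
  by (auto simp: agree_def)

context
  fixes D :: "'v multiset set" and f g f' g' :: "('v, 'c :: comm_ring_1) mfps"
  assumes agree: "agree D f f'" "agree D g g'"
begin

lemma agree_add: "agree D (f + g) (f' + g')"
  using agree by (simp add: agree_def plus_mfps.rep_eq)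

lemma agree_diff: "agree D (f - g) (f' - g')"
  using agree by (simp add: agree_def minus_mfps.rep_eq)

lemma agree_mult: "down_closed D \<Longrightarrow> agree D (f * g) (f' * g')"
proof -
  assume D: "down_closed D"
  have "mcoeff f a * mcoeff g b = mcoeff f' a * mcoeff g' b" if "a + b \<in> D" for a b
  proof -
    have "a \<in> D" "b \<in> D" using D that unfolding down_closed_def by blast+
    then show ?thesis using agree by (simp add: agree_def)
  qed
  then show ?thesis
    unfolding agree_def times_mfps.rep_eq by (intro ballI sum.cong) auto
qed

end

text \<open>A series with constant term 1 can be cancelled by induction on the degree: since
  \<open>h\<close> has no constant term, the coefficient of \<open>h * f\<close> at \<open>m\<close>
  involves \<open>f\<close> only at proper divisors of \<open>m\<close>, where \<open>f\<close> and
  \<open>g\<close> already agree.\<close>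

lemma agree_cancel:
  fixes h :: "('v, 'c :: comm_ring_1) mfps"
  assumes D: "down_closed D" and h: "mcoeff h {#} = 0" and ag: "agree D ((1 + h) * f) ((1 + h) * g)"
  shows "agree D f g"
  unfolding agree_def
proof
  fix m assume "m \<in> D"
  then show "mcoeff f m = mcoeff g m"
  proof (induction m rule: measure_induct_rule[where f = size])
    case (less m)
    have "mcoeff (h * f) m = mcoeff (h * g) m"
      unfolding times_mfps.rep_eq
    proof (rule sum.cong, simp, clarify)
      fix a b assume m: "m = a + b"
      show "mcoeff h a * mcoeff f b = mcoeff h a * mcoeff g b"
      proof (cases "a = {#}")
        case False
        moreover have "b \<in> D" using D less.prems m unfolding down_closed_def by blast
        ultimately show ?thesis using less.IH[of b] m by (simp add: nonempty_has_size)
      qed (simp add: h)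
    qed
    moreover have "mcoeff ((1 + h) * f) m = mcoeff ((1 + h) * g) m"
      using ag less.prems by (simp add: agree_def)
    ultimately show ?case by (simp add: distrib_right plus_mfps.rep_eq)
  qed
qed

text \<open>Multiplication by a variable gains one degree of precision. This lets a fixed-point
  equation whose unknown stands behind a variable determine its solution degree by degree.\<close>

lemma agree_degree_mvar:
  fixes f :: "('v, 'c :: comm_ring_1) mfps"
  assumes "agree {m. size m < k} f g"
  shows "agree {m. size m < Suc k} (mvar v * f) (mvar v * g)"
  using assms by (auto simp: agree_def mcoeff_mvar_times size_Diff_singleton dest: multi_member_split)

lemma down_closed_degree: "down_closed {m. size m < k}"
  by (auto simp: down_closed_def)

lemma down_closed_atMost: "down_closed {m. \<forall>a\<in>#m. a \<le> (v :: nat)}"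
  by (auto simp: down_closed_def)

lemma mconst_zero [simp]: "mconst 0 = (0 :: ('v, 'c :: comm_ring_1) mfps)"
  and mconst_one [simp]: "mconst 1 = (1 :: ('v, 'c :: comm_ring_1) mfps)"
  and mconst_add: "mconst (x + y) = (mconst x + mconst y :: ('v, 'c :: comm_ring_1) mfps)"
  by (rule mfps_eqI; simp add: mconst.rep_eq zero_mfps.rep_eq one_mfps.rep_eq plus_mfps.rep_eq)+

lemma mconst_mult: "mconst (x * y) = (mconst x * mconst y :: ('v, 'c :: comm_ring_1) mfps)"
  by (rule mfps_eqI) (simp add: mconst.rep_eq mcoeff_mconst_times)

section \<open>Trees sorted by their root label\<close>

abbreviation tree_mon :: "'a tree \<Rightarrow> 'a multiset" where
  "tree_mon t \<equiv> mset (inorder t)"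

lemma finite_fibres_tree_mon [simp]: "finite_fibres tree_mon I"
proof (rule finite_fibres_subset)
  show "finite_fibres tree_mon (UNIV :: 'a tree set)"
    unfolding finite_fibres_def
  proof
    fix m :: "'a multiset"
    have "{t. t \<in> UNIV \<and> tree_mon t = m} \<subseteq> {t. size t = size m \<and> set_tree t \<subseteq> set_mset m}"
      by auto
    then show "finite {t. t \<in> UNIV \<and> tree_mon t = m}"
      by (rule finite_subset) (rule finite_trees_of_size, simp)
  qed
qed simp

text \<open>The value 0 for \<open>Leaf\<close> passes every bound, so the families filtered by root
  label below are kept free of \<open>Leaf\<close>. Labels being positive, no tree in them passes
  the bound 0.\<close>

fun root_label :: "nat tree \<Rightarrow> nat" where
  "root_label Leaf = 0"
| "root_label (Node l a r) = a"

lemma gser_Node: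
  fixes c :: "nat tree \<Rightarrow> 'c :: comm_ring_1"
  assumes "\<And>l r. l \<in> I \<Longrightarrow> r \<in> J \<Longrightarrow> c (Node l v r) = f l * g r"
  shows "gser c tree_mon ((\<lambda>(l, r). Node l v r) ` (I \<times> J))
       = mvar v * (gser f tree_mon I * gser g tree_mon J)"
proof -
  have "gser c tree_mon ((\<lambda>(l, r). Node l v r) ` (I \<times> J))
      = gser (c \<circ> (\<lambda>(l, r). Node l v r)) (tree_mon \<circ> (\<lambda>(l, r). Node l v r)) (I \<times> J)"
    by (rule gser_reindex) (auto simp: inj_on_def)
  also have "\<dots> = gser (\<lambda>(l, r). f l * g r)
      (\<lambda>p. add_mset v ((\<lambda>(l, r). tree_mon l + tree_mon r) p)) (I \<times> J)"
    by (rule gser_cong) (auto simp: assms)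
  finally show ?thesis by (simp add: mvar_times_gser gser_times)
qed

text \<open>The series of a possibly absent child together with the edge leading to it: the edge
  weight depends only on whether the root label of the child is at most \<open>v\<close>, and
  \<open>e\<close> accounts for the absent child.\<close>

lemma gser_branch:
  fixes c :: "nat tree \<Rightarrow> 'c :: comm_ring_1" and v :: nat
  assumes "Leaf \<notin> X"
  defines "S \<equiv> gser c tree_mon {t \<in> X. root_label t \<le> v}"
  shows "gser (\<lambda>t. (case t of Leaf \<Rightarrow> e | Node _ b _ \<Rightarrow> if b \<le> v then p else q) * c t) tree_mon
           (insert Leaf X)
       = mconst (e * c Leaf) + mconst p * S + mconst q * (gser c tree_mon X - S)"
    (is "gser ?c _ _ = _")
proof -
  let ?L = "{t \<in> X. root_label t \<le> v}" and ?U = "{t \<in> X. \<not> root_label t \<le> v}"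
  have X: "gser d tree_mon X = gser d tree_mon ?L + gser d tree_mon ?U" for d :: "nat tree \<Rightarrow> 'c"
    by (subst gser_Un[symmetric]) (auto intro: gser_cong)
  have "gser ?c tree_mon (insert Leaf X) = gser ?c tree_mon {Leaf} + gser ?c tree_mon X"
    using assms by (subst gser_Un[symmetric]) auto
  moreover have "gser ?c tree_mon {Leaf} = mconst (e * c Leaf)"
    by (rule mfps_eqI) (auto simp: gser.rep_eq mconst.rep_eq conj_commute cong: conj_cong)
  moreover have "gser ?c tree_mon ?L = mconst p * S"
    unfolding S_def gser_cmult[symmetric] using assms(1)
    by (intro gser_cong) (auto split: tree.splits)
  moreover have "gser ?c tree_mon ?U = mconst q * gser c tree_mon ?U"
    unfolding gser_cmult[symmetric] using assms(1)
    by (intro gser_cong) (auto split: tree.splits)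
  ultimately show ?thesis using X[of ?c] X[of c] by (simp add: S_def)
qed

text \<open>A tree whose monomial involves only indices up to \<open>v\<close> has in particular a
  root label up to \<open>v\<close>. On such monomials the truncated series has already reached its
  limit.\<close>

lemma agree_root_le:
  assumes "Leaf \<notin> X"
  shows "agree {m. \<forall>a\<in>#m. a \<le> v} (gser c tree_mon X)
           (gser c tree_mon {t \<in> X. root_label t \<le> v})"
  unfolding agree_def gser.rep_eq
proof (intro ballI sum.cong refl)
  fix m assume m: "m \<in> {m. \<forall>a\<in>#m. a \<le> v}"
  have "root_label t \<le> v" if "t \<in> X" "tree_mon t = m" for t
    using that m assms by (cases t) auto
  then show "{i \<in> X. tree_mon i = m} = {i \<in> {t \<in> X. root_label t \<le> v}. tree_mon i = m}"
    by auto
qed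

section \<open>The two systems of equations\<close>

fun tree_wt :: "nat tree \<Rightarrow> edge_poly" where
  "tree_wt Leaf = 1"
| "tree_wt (Node l a r) =
     ((case l of Leaf \<Rightarrow> 1 | Node _ b _ \<Rightarrow> if b \<le> a then lam_bar else lam) * tree_wt l)
     * ((case r of Leaf \<Rightarrow> 1 | Node _ b _ \<Rightarrow> if a \<le> b then rho_bar else rho) * tree_wt r)"

lemma tree_wt_eq:
  "tree_wt t = lam_bar ^ lasc t * lam ^ ldes t * rho_bar ^ rasc t * rho ^ rdes t"
proof (induction t)
  case (Node l a r)
  then show ?case
    by (cases l; cases r) (auto simp: lasc_def ldes_def rasc_def rdes_def power_add mult_ac)
qed (simp add: lasc_def ldes_def rasc_def rdes_def)

definition trees :: "nat tree set" where
  "trees = {t. t \<noteq> Leaf \<and> (\<forall>a\<in>set_tree t. a > 0)}"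

abbreviation tree_series :: series where
  "tree_series \<equiv> gser tree_wt tree_mon trees"

definition rooted_series :: "nat \<Rightarrow> series" where
  "rooted_series v = gser tree_wt tree_mon {t \<in> trees. root_label t \<le> v}"

lemma rooted_series_0: "rooted_series 0 = 0"
proof -
  have eq: "{t \<in> trees. root_label t \<le> 0} = {}"
    by (auto simp: trees_def elim: root_label.elims)
  show ?thesis unfolding rooted_series_def eq by simp
qed

text \<open>Splits off the trees with root label exactly \<open>Suc v\<close>. Equal labels form an
  ascent on both kinds of edges. Hence left ascents go to root labels up to \<open>Suc v\<close>,
  which puts the unknown on the right-hand side, whereas right descents go to root labels up to
  \<open>v\<close>.\<close>

lemma rooted_series_Suc:
  "rooted_series (Suc v) = rooted_series v + mvar (Suc v)
     * ((1 + mconst lam_bar * rooted_series (Suc v)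
          + mconst lam * (tree_series - rooted_series (Suc v)))
      * (1 + mconst rho * rooted_series v + mconst rho_bar * (tree_series - rooted_series v)))"
proof -
  let ?N = "(\<lambda>(l, r). Node l (Suc v) r) ` (insert Leaf trees \<times> insert Leaf trees)"
  have [simp]: "Leaf \<notin> trees" by (simp add: trees_def)
  have "t \<in> ?N" if t: "t \<in> trees" "root_label t = Suc v" for t
    using that by (cases t) (auto simp: trees_def)
  then have "{t \<in> trees. root_label t \<le> Suc v} = {t \<in> trees. root_label t \<le> v} \<union> ?N"
    by (auto simp: le_Suc_eq) (auto simp: trees_def)
  moreover have "{t \<in> trees. root_label t \<le> v} \<inter> ?N = {}" by auto
  ultimately have "rooted_series (Suc v) = rooted_series v + gser tree_wt tree_mon ?N"
    unfolding rooted_series_def by (simp only: gser_Un finite_fibres_tree_mon)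
  also have "gser tree_wt tree_mon ?N = mvar (Suc v) *
      (gser (\<lambda>t. (case t of Leaf \<Rightarrow> 1 | Node _ b _ \<Rightarrow> if b \<le> Suc v then lam_bar else lam)
               * tree_wt t) tree_mon (insert Leaf trees)
     * gser (\<lambda>t. (case t of Leaf \<Rightarrow> 1 | Node _ b _ \<Rightarrow> if b \<le> v then rho else rho_bar)
               * tree_wt t) tree_mon (insert Leaf trees))"
    by (rule gser_Node) (auto split: tree.splits)
  finally show ?thesis by (simp add: gser_branch flip: rooted_series_def)
qed

text \<open>
  A Motzkin tree encodes an interlacing partition with a letter at each element: the right child of
  a node is the next element of its block, the left subtree is the partition of the gap between
  them.
\<close>

fun motzkin :: "'a tree \<Rightarrow> bool" where
  "motzkin Leaf \<longleftrightarrow> True"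
| "motzkin (Node l a r) \<longleftrightarrow> motzkin l \<and> motzkin r \<and> (r = Leaf \<longrightarrow> l = Leaf)"

text \<open>Shared by trees and partitions: \<open>step\<close> tells steppers from jumpers, and
  \<open>des\<close> stands for a mark on the start of the arc or, equivalently later, for a descent
  of the letters along it.\<close>

definition arc_wt :: "bool \<Rightarrow> bool \<Rightarrow> edge_poly" where
  "arc_wt step des =
     (if step then if des then lam + rho else lam_bar + rho_bar
      else if des then lam * rho else lam_bar * rho_bar)"

fun motzkin_wt :: "nat tree \<Rightarrow> edge_poly" where
  "motzkin_wt Leaf = 1"
| "motzkin_wt (Node l a r) =
     motzkin_wt l * ((case r of Leaf \<Rightarrow> 1 | Node _ b _ \<Rightarrow> arc_wt (l = Leaf) (b < a)) * motzkin_wt r)"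

definition motzkin_trees :: "nat tree set" where
  "motzkin_trees = {t. t \<noteq> Leaf \<and> motzkin t \<and> (\<forall>a\<in>set_tree t. a > 0)}"

abbreviation motzkin_series :: series where
  "motzkin_series \<equiv> gser motzkin_wt tree_mon motzkin_trees"

definition rooted_motzkin :: "nat \<Rightarrow> series" where
  "rooted_motzkin v = gser motzkin_wt tree_mon {t \<in> motzkin_trees. root_label t \<le> v}"

lemma rooted_motzkin_0: "rooted_motzkin 0 = 0"
proof -
  have eq: "{t \<in> motzkin_trees. root_label t \<le> 0} = {}"
    by (auto simp: motzkin_trees_def elim: root_label.elims)
  show ?thesis unfolding rooted_motzkin_def eq by simp
qed

text \<open>The Motzkin condition leaves two cases for the root: an empty left subtree with any
  right one, or two nonempty subtrees. The left subtree is joined without any comparison of labels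
  and so contributes the full series \<open>F\<close>; a descent from \<open>Suc v\<close> goes to a
  label up to \<open>v\<close>.\<close>

lemma rooted_motzkin_Suc:
  fixes v :: nat
  defines "V \<equiv> rooted_motzkin v" and "F \<equiv> motzkin_series"
  shows "rooted_motzkin (Suc v) = V + mvar (Suc v)
     * (1 + mconst (lam + rho) * V + mconst (lam_bar + rho_bar) * (F - V)
        + F * (mconst (lam * rho) * V + mconst (lam_bar * rho_bar) * (F - V)))"
proof -
  let ?M = motzkin_trees
  let ?f = "\<lambda>(l, r). Node l (Suc v) r"
  let ?N = "?f ` ({Leaf} \<times> insert Leaf ?M)" and ?N' = "?f ` (?M \<times> insert Leaf ?M)"
  let ?N'' = "?f ` (?M \<times> ?M)"
  have [simp]: "Leaf \<notin> ?M" by (simp add: motzkin_trees_def)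
  have "t \<in> ?N \<union> ?N''" if t: "t \<in> ?M" "root_label t = Suc v" for t
  proof (cases t)
    case (Node l a r)
    with t have "l = Leaf \<and> r \<in> insert Leaf ?M \<or> l \<in> ?M \<and> r \<in> ?M"
      by (auto simp: motzkin_trees_def)
    with Node t show ?thesis by (auto simp: image_iff)
  qed (use t in simp)
  then have "{t \<in> ?M. root_label t \<le> Suc v} = {t \<in> ?M. root_label t \<le> v} \<union> (?N \<union> ?N'')"
    by (auto simp: le_Suc_eq) (auto simp: motzkin_trees_def)
  moreover have "{t \<in> ?M. root_label t \<le> v} \<inter> (?N \<union> ?N'') = {}" "?N \<inter> ?N'' = {}" by auto
  ultimately have "rooted_motzkin (Suc v)
      = V + (gser motzkin_wt tree_mon ?N + gser motzkin_wt tree_mon ?N'')"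
    unfolding rooted_motzkin_def V_def by (simp only: gser_Un finite_fibres_tree_mon)
  also have "gser motzkin_wt tree_mon ?N = mvar (Suc v) * (gser (\<lambda>_. 1) tree_mon {Leaf} *
      gser (\<lambda>t. (case t of Leaf \<Rightarrow> 1 | Node _ b _ \<Rightarrow> if b \<le> v then lam + rho else lam_bar + rho_bar)
               * motzkin_wt t) tree_mon (insert Leaf ?M))"
    by (rule gser_Node) (auto simp: arc_wt_def split: tree.splits)
  also have "\<dots> = mvar (Suc v)
      * (1 + mconst (lam + rho) * V + mconst (lam_bar + rho_bar) * (F - V))"
    by (simp add: gser_branch gser_one V_def F_def flip: rooted_motzkin_def)
  also have "gser motzkin_wt tree_mon ?N'' = mvar (Suc v) * (F *
      gser (\<lambda>t. (case t of Leaf \<Rightarrow> 0 | Node _ b _ \<Rightarrow> if b \<le> v then lam * rho else lam_bar * rho_bar)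
               * motzkin_wt t) tree_mon ?M)"
    unfolding F_def
  proof (rule gser_Node)
    fix l r assume "l \<in> ?M" "r \<in> ?M"
    then have "l \<noteq> Leaf" "r \<noteq> Leaf" by (auto simp: motzkin_trees_def)
    then show "motzkin_wt (Node l (Suc v) r) = motzkin_wt l *
        ((case r of Leaf \<Rightarrow> 0 | Node _ b _ \<Rightarrow> if b \<le> v then lam * rho else lam_bar * rho_bar)
          * motzkin_wt r)"
      by (cases r) (simp_all add: arc_wt_def less_Suc_eq_le)
  qed
  \<comment> \<open>The coefficient of \<open>Leaf\<close> is 0, so inserting it changes nothing and
    gives the form required by \<open>gser_branch\<close>.\<close>
  also have "gser (\<lambda>t. (case t of Leaf \<Rightarrow> 0 | Node _ b _ \<Rightarrow> if b \<le> v then lam * rho else lam_bar * rho_bar)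
               * motzkin_wt t) tree_mon ?M
      = gser (\<lambda>t. (case t of Leaf \<Rightarrow> 0 | Node _ b _ \<Rightarrow> if b \<le> v then lam * rho else lam_bar * rho_bar)
               * motzkin_wt t) tree_mon (insert Leaf ?M)" (is "?l = gser ?c tree_mon _")
  proof -
    have "gser ?c tree_mon {Leaf} = 0"
      by (rule mfps_eqI) (simp add: gser.rep_eq zero_mfps.rep_eq sum.neutral)
    then show ?thesis by (subst insert_is_Un, subst gser_Un) auto
  qed
  also have "\<dots> = mconst (lam * rho) * V + mconst (lam_bar * rho_bar) * (F - V)"
    by (simp add: gser_branch V_def F_def flip: rooted_motzkin_def)
  finally show ?thesis by (simp add: distrib_left)
qed

text \<open>
  With \<open>B v = 1 + r' * g - (r' - r) * S v\<close>, the combination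
  \<open>z = (r' - r) * A v + (l' - l) * B v\<close> does not depend on \<open>v\<close>; this linearises the
  quadratic recursion for \<open>S\<close>.
\<close>

lemma linearised_solution:
  fixes S V x :: "nat \<Rightarrow> 'a :: comm_ring_1" and l' l r' r g :: 'a
  defines "A \<equiv> \<lambda>v. 1 + l * g + (l' - l) * S v"
    and "z \<equiv> l' + r' - l - r + (l' * r' - l * r) * g"
  assumes S: "S 0 = 0"
      "\<And>v. S (Suc v) = S v + x v * ((1 + l' * S (Suc v) + l * (g - S (Suc v)))
                                   * (1 + r * S v + r' * (g - S v)))"
    and V: "V 0 = 0" "\<And>v. V (Suc v) = V v + x v * ((1 + l' * g) * (1 + r' * g) - z * V v)"
  shows "A v * V v = (1 + l' * g) * S v"
proof (induction v)
  case (Suc v)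
  define B where "B = 1 + r * S v + r' * (g - S v)"
  define T where "T = x v * (A (Suc v) * B)"
  have S1: "S (Suc v) = S v + T"
    by (subst S(2)) (simp add: T_def A_def B_def algebra_simps)
  then have A1: "A (Suc v) = A v + (l' - l) * T" by (simp add: A_def algebra_simps)
  have z: "z = (r' - r) * A v + (l' - l) * B" by (simp add: z_def A_def B_def algebra_simps)
  have "A (Suc v) * V (Suc v)
      = A (Suc v) * V v + x v * A (Suc v) * ((1 + l' * g) * (1 + r' * g) - z * V v)"
    by (simp add: V(2) algebra_simps)
  also have "A (Suc v) * V v = A v * V v + (l' - l) * T * V v" by (subst A1) (simp add: algebra_simps)
  also have "(l' - l) * T * V v = x v * A (Suc v) * ((l' - l) * B * V v)"
    by (simp add: T_def algebra_simps)
  \<comment> \<open>Inserting the decomposition of \<open>z\<close> cancels the terms with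
    \<open>B * V v\<close>; what remains contains \<open>V v\<close> only through
    \<open>A v * V v\<close>.\<close>
  also have "A v * V v + x v * A (Suc v) * ((l' - l) * B * V v)
        + x v * A (Suc v) * ((1 + l' * g) * (1 + r' * g) - z * V v)
      = A v * V v + x v * A (Suc v) * ((1 + l' * g) * (1 + r' * g) - (r' - r) * (A v * V v))"
    unfolding z by (simp add: algebra_simps)
  \<comment> \<open>After the induction hypothesis the bracket is \<open>1 + l' * g\<close> times
    \<open>1 + r' * g - (r' - r) * S v\<close>, and the latter is \<open>B\<close>.\<close>
  also have "\<dots> = (1 + l' * g) * S v + x v * A (Suc v) * ((1 + l' * g) * B)"
    unfolding Suc.IH by (simp add: B_def algebra_simps)
  also have "\<dots> = (1 + l' * g) * S (Suc v)"
    unfolding S1 by (simp add: T_def algebra_simps)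
  finally show ?case .
qed (simp add: S V)

text \<open>Both series are fixed points of the map sending \<open>g\<close> to the limit of
  \<open>V g v\<close> for growing \<open>v\<close>: Motzkin trees by their recursion, labeled trees
  by the linearisation. Each step of \<open>V g\<close> uses \<open>g\<close> only behind a
  variable, so the fixed point is determined degree by degree.\<close>

lemma tree_series_eq_motzkin_series: "tree_series = motzkin_series"
proof -
  let ?l' = "mconst lam_bar :: series" and ?l = "mconst lam :: series"
    and ?r' = "mconst rho_bar :: series" and ?r = "mconst rho :: series"
  define z where "z g = ?l' + ?r' - ?l - ?r + (?l' * ?r' - ?l * ?r) * g" for g
  define step where
    "step v g f = f + mvar (Suc v) * ((1 + ?l' * g) * (1 + ?r' * g) - z g * f)" for v g f
  \<comment> \<open>The linear recursion with the total series as a parameter \<open>g\<close>, so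
    that it can be evaluated at both series and compared.\<close>
  define V where "V g = rec_nat 0 (\<lambda>v. step v g)" for g
  have V_0: "V g 0 = 0" and V_Suc: "V g (Suc v) = step v g (V g v)" for g v
    by (simp_all add: V_def)
  have motz: "rooted_motzkin v = V motzkin_series v" for v
  proof (induction v)
    case (Suc v)
    show ?case
      unfolding V_Suc rooted_motzkin_Suc Suc.IH step_def z_def mconst_add mconst_mult
      by (simp add: algebra_simps)
  qed (simp add: rooted_motzkin_0 V_0)
  have V_Suc': "V g (Suc v) = V g v + mvar (Suc v) * ((1 + ?l' * g) * (1 + ?r' * g)
      - (?l' + ?r' - ?l - ?r + (?l' * ?r' - ?l * ?r) * g) * V g v)" for g v
    unfolding V_Suc step_def z_def ..
  have tree: "(1 + ?l * tree_series + (?l' - ?l) * rooted_series v) * V tree_series v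
      = (1 + ?l' * tree_series) * rooted_series v" for v
    by (rule linearised_solution[where x = "\<lambda>v. mvar (Suc v)" and r = ?r and r' = ?r',
          OF rooted_series_0 rooted_series_Suc V_0 V_Suc'])
  have agree_motz: "agree {m. \<forall>a\<in>#m. a \<le> v} motzkin_series (V motzkin_series v)" for v
    unfolding motz[symmetric] rooted_motzkin_def
    by (rule agree_root_le) (simp add: motzkin_trees_def)
  have agree_tree: "agree {m. \<forall>a\<in>#m. a \<le> v} tree_series (V tree_series v)" for v
  proof -
    let ?D = "{m. \<forall>a\<in>#m. a \<le> v}"
    have S: "agree ?D tree_series (rooted_series v)"
      unfolding rooted_series_def by (rule agree_root_le) (simp add: trees_def)
    \<comment> \<open>Replacing the rooted series by \<open>tree_series\<close> on \<open>?D\<close>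
      turns the denominator of the linearisation into \<open>1 + ?l' * tree_series\<close>, which is
      also the factor in its numerator.\<close>
    have "agree ?D (1 + ?l * tree_series + (?l' - ?l) * tree_series)
        (1 + ?l * tree_series + (?l' - ?l) * rooted_series v)"
      by (intro agree_add agree_mult agree_refl S down_closed_atMost)
    then have "agree ?D (1 + ?l' * tree_series)
        (1 + ?l * tree_series + (?l' - ?l) * rooted_series v)"
      by (simp add: algebra_simps)
    then have "agree ?D ((1 + ?l' * tree_series) * V tree_series v)
        ((1 + ?l * tree_series + (?l' - ?l) * rooted_series v) * V tree_series v)"
      by (intro agree_mult agree_refl down_closed_atMost)
    moreover have "agree ?D ((1 + ?l' * tree_series) * rooted_series v)
        ((1 + ?l' * tree_series) * tree_series)"
      by (intro agree_mult agree_refl down_closed_atMost agree_sym[OF S])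
    ultimately have ag: "agree ?D ((1 + ?l' * tree_series) * V tree_series v)
        ((1 + ?l' * tree_series) * tree_series)"
      unfolding tree by (rule agree_trans)
    \<comment> \<open>A nonempty tree has a nonempty monomial, so the common factor has constant
      term 1 and can be cancelled.\<close>
    have "{t \<in> trees. tree_mon t = {#}} = {}" by (auto simp: trees_def)
    then have h: "mcoeff (?l' * tree_series) {#} = 0"
      unfolding mcoeff_mconst_times gser.rep_eq by (simp only: sum.empty mult_zero_right)
    show ?thesis by (rule agree_sym[OF agree_cancel[OF down_closed_atMost h ag]])
  qed
  have "agree {m. size m < k} tree_series motzkin_series" for k
  proof (induction k)
    case (Suc k)
    let ?D = "{m :: nat multiset. size m < Suc k}"
    \<comment> \<open>Agreement of the parameters below degree \<open>k\<close> suffices for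
      \<open>V\<close> below degree \<open>Suc k\<close>: the previous stage is covered by the
      induction on \<open>v\<close>, and the new summand carries a variable.\<close>
    have V: "agree ?D (V tree_series v) (V motzkin_series v)" for v
    proof (induction v)
      case (Suc v)
      then have "agree {m. size m < k} (V tree_series v) (V motzkin_series v)"
        by (auto simp: agree_def)
      with \<open>agree {m. size m < k} tree_series motzkin_series\<close>
      have "agree {m. size m < k}
          ((1 + ?l' * tree_series) * (1 + ?r' * tree_series) - z tree_series * V tree_series v)
          ((1 + ?l' * motzkin_series) * (1 + ?r' * motzkin_series)
            - z motzkin_series * V motzkin_series v)"
        unfolding z_def
        by (intro agree_add agree_diff agree_mult agree_refl down_closed_degree)
      then show ?case
        unfolding V_Suc step_def by (intro agree_add Suc.IH agree_degree_mvar)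
    qed (simp add: V_0)
    show ?case
      unfolding agree_def
    proof
      fix m assume m: "m \<in> ?D"
      \<comment> \<open>A single monomial involves finitely many variables, so a finite stage
        \<open>v\<close> already gives its coefficient; this replaces the limit.\<close>
      obtain v where v: "\<forall>a\<in>#m. a \<le> v"
        using finite_nat_set_iff_bounded_le finite_set_mset by blast
      then show "mcoeff tree_series m = mcoeff motzkin_series m"
        using agree_tree[of v] agree_motz[of v] V[of v] m by (simp add: agree_def)
    qed
  qed (simp add: agree_def)
  then show ?thesis by (intro mfps_eqI) (metis agree_def lessI mem_Collect_eq)
qed

section \<open>Ribbons and blocks\<close>

text \<open>The arcs of the arc diagram of a set partition. Unlike \<open>next_in\<close>, they are
  described directly under adding blocks and under gluing.\<close>

definition arcs :: "nat set set \<Rightarrow> (nat \<times> nat) set" where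
  "arcs P = {(i, j). i < j \<and> (\<exists>B\<in>P. i \<in> B \<and> j \<in> B \<and> (\<forall>k\<in>B. k \<le> i \<or> j \<le> k))}"

text \<open>The value 0 marks the positions outside of \<open>A\<close>.\<close>

definition words :: "nat set \<Rightarrow> (nat \<Rightarrow> nat) set" where
  "words A = {w. \<forall>i. w i > 0 \<longleftrightarrow> i \<in> A}"

definition word_mon :: "nat set \<Rightarrow> (nat \<Rightarrow> nat) \<Rightarrow> nat multiset" where
  "word_mon A w = image_mset w (mset_set A)"

text \<open>Comparisons are prescribed inside blocks only. For a single block these are the words of
  a ribbon, spread over the elements of the block.\<close>

definition desc_words :: "nat set \<Rightarrow> nat set set \<Rightarrow> (nat \<Rightarrow> nat) set" where
  "desc_words M P = {w \<in> words (\<Union>P). \<forall>(i, j)\<in>arcs P. i \<in> M \<longleftrightarrow> w j < w i}"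

lemma finite_fibres_words:
  assumes "finite A"
  shows "finite_fibres (word_mon A) (words A)"
  unfolding finite_fibres_def
proof
  fix m
  have "{w. w \<in> words A \<and> word_mon A w = m}
      \<subseteq> {w. \<forall>i. (i \<in> A \<longrightarrow> w i \<in> set_mset m) \<and> (i \<notin> A \<longrightarrow> w i = 0)}"
    using assms by (auto simp: words_def word_mon_def)
  then show "finite {w. w \<in> words A \<and> word_mon A w = m}"
    by (rule finite_subset) (rule finite_set_of_finite_funs[OF assms], simp)
qed

lemma words_empty: "words {} = {\<lambda>_. 0}"
  by (auto simp: words_def)

text \<open>Words vanish off their supports, so on disjoint supports pointwise addition merges two
  words, and restriction recovers them.\<close>

lemma bij_betw_words_Un:
  assumes "A \<inter> B = {}"
  shows "bij_betw (\<lambda>(v, w) i. v i + w i) (words A \<times> words B) (words (A \<union> B))"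
  unfolding bij_betw_def
proof (intro conjI equalityI subsetI)
  have "v = v' \<and> w = w'"
    if "v \<in> words A" "w \<in> words B" "v' \<in> words A" "w' \<in> words B"
      and eq: "(\<lambda>i. v i + w i) = (\<lambda>i. v' i + w' i)" for v w v' w'
  proof -
    have "v i = v' i \<and> w i = w' i" for i
    proof -
      have "(v i = 0 \<and> v' i = 0) \<or> (w i = 0 \<and> w' i = 0)"
        using that(1-4) assms unfolding words_def by (cases "i \<in> A") auto
      with fun_cong[OF eq, of i] show ?thesis by auto
    qed
    then show ?thesis by auto
  qed
  then show "inj_on (\<lambda>(v, w) i. v i + w i) (words A \<times> words B)"
    by (auto intro!: inj_onI)
next
  fix u assume u: "u \<in> words (A \<union> B)"
  let ?v = "\<lambda>i. if i \<in> A then u i else 0" and ?w = "\<lambda>i. if i \<in> B then u i else 0"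
  have "?v \<in> words A" "?w \<in> words B" using u by (auto simp: words_def)
  moreover have "u i = ?v i + ?w i" for i
    using assms u unfolding words_def by (cases "i \<in> A \<union> B") auto
  then have "u = (\<lambda>(v, w) i. v i + w i) (?v, ?w)" by (simp add: fun_eq_iff)
  ultimately show "u \<in> (\<lambda>(v, w) i. v i + w i) ` (words A \<times> words B)" by blast
qed (auto simp: words_def, metis less_irrefl)

lemma word_mon_Un:
  assumes "finite A" "finite B" "A \<inter> B = {}" "v \<in> words A" "w \<in> words B"
  shows "word_mon (A \<union> B) (\<lambda>i. v i + w i) = word_mon A v + word_mon B w"
proof -
  have "image_mset (\<lambda>i. v i + w i) (mset_set A) = image_mset v (mset_set A)"
    "image_mset (\<lambda>i. v i + w i) (mset_set B) = image_mset w (mset_set B)"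
    using assms by (auto simp: words_def intro!: image_mset_cong)
  then show ?thesis using assms by (simp add: word_mon_def mset_set_Union)
qed

text \<open>Translates arcs into consecutive list positions, the indexing used by
  \<open>pieces\<close> and by ribbon words.\<close>

lemma arcs_sorted:
  assumes "sorted_wrt (<) xs"
  shows "arcs {set xs} = {(xs ! k, xs ! Suc k) | k. Suc k < length xs}"
proof -
  have less_iff: "xs ! k < xs ! l \<longleftrightarrow> k < l" if "k < length xs" "l < length xs" for k l
    using assms that by (metis linorder_cases order_less_asym sorted_wrt_nth_less less_irrefl)
  have le_iff: "xs ! k \<le> xs ! l \<longleftrightarrow> k \<le> l" if "k < length xs" "l < length xs" for k l
    using less_iff[of l k] that by linarith
  show ?thesis
  proof (intro equalityI subrelI)
    fix i j assume "(i, j) \<in> arcs {set xs}"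
    then have ij: "i < j" "i \<in> set xs" "j \<in> set xs" "\<And>k. k \<in> set xs \<Longrightarrow> k \<le> i \<or> j \<le> k"
      by (auto simp: arcs_def)
    then obtain k l where kl: "k < length xs" "l < length xs" "i = xs ! k" "j = xs ! l"
      by (auto simp: in_set_conv_nth)
    then have "k < l" using ij(1) less_iff by simp
    then have "xs ! Suc k \<le> i \<or> j \<le> xs ! Suc k" using kl by (intro ij(4)) auto
    with kl \<open>k < l\<close> have "l \<le> Suc k" by (auto simp: le_iff)
    with \<open>k < l\<close> have "l = Suc k" by simp
    with kl show "(i, j) \<in> {(xs ! k, xs ! Suc k) | k. Suc k < length xs}" by auto
  next
    fix i j assume "(i, j) \<in> {(xs ! k, xs ! Suc k) | k. Suc k < length xs}"
    then obtain k where k: "Suc k < length xs" "i = xs ! k" "j = xs ! Suc k" by auto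
    have "m \<le> i \<or> j \<le> m" if "m \<in> set xs" for m
      using that k by (auto simp: in_set_conv_nth le_iff)
    with k show "(i, j) \<in> arcs {set xs}" by (auto simp: arcs_def less_iff)
  qed
qed

section \<open>Ribbon Schur functions as series of words placed on one block\<close>

lemma pieces_eq_Nil_iff: "pieces M xs = [] \<longleftrightarrow> xs = []"
  by (cases xs) (auto split: list.splits)

lemma sum_list_pieces: "sum_list (map length (pieces M xs)) = length xs"
  by (induction xs) (auto split: list.splits)

lemma comp_set_Cons:
  "comp_set (a # as) = (if as = [] then {} else insert a ((+) a ` comp_set as))"
proof (cases "as = []")
  case False
  show ?thesis
  proof (intro equalityI subsetI)
    fix x assume "x \<in> comp_set (a # as)"
    then obtain j where j: "1 \<le> j" "j < Suc (length as)" "x = sum_list (take j (a # as))"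
      by (auto simp: comp_set_def)
    then obtain i where i: "j = Suc i" by (cases j) auto
    show "x \<in> (if as = [] then {} else insert a ((+) a ` comp_set as))"
    proof (cases "i = 0")
      case False
      with i j have "sum_list (take i as) \<in> comp_set as" by (auto simp: comp_set_def)
      with i j \<open>as \<noteq> []\<close> show ?thesis by simp
    qed (use i j \<open>as \<noteq> []\<close> in simp)
  next
    fix x assume "x \<in> (if as = [] then {} else insert a ((+) a ` comp_set as))"
    then consider "x = a" | j where "1 \<le> j" "j < length as" "x = a + sum_list (take j as)"
      using False by (auto simp: comp_set_def)
    then show "x \<in> comp_set (a # as)"
    proof cases
      case 1
      then show ?thesis using False by (auto simp: comp_set_def intro!: exI[of _ 1])
    next
      case (2 j)
      then show ?thesis by (auto simp: comp_set_def intro!: exI[of _ "Suc j"])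
    qed
  qed
qed (auto simp: comp_set_def)

text \<open>The proper partial sums of the piece sizes are the positions of the breaks. A mark on
  the last element creates no further piece, hence the strict bound by the length.\<close>

lemma comp_set_pieces:
  "comp_set (map length (pieces M xs)) = {k. 1 \<le> k \<and> k < length xs \<and> xs ! (k - 1) \<in> M}"
proof (induction xs)
  case (Cons x xs)
  show ?case
  proof (cases xs)
    case (Cons y ys)
    then obtain p ps where p: "pieces M xs = p # ps"
      using pieces_eq_Nil_iff[of M xs] by (cases "pieces M xs") auto
    let ?S = "{k. 1 \<le> k \<and> k < length xs \<and> xs ! (k - 1) \<in> M}"
    \<comment> \<open>Prepending \<open>x\<close> either adds a piece of size 1 or enlarges the
      first piece; in both cases the old partial sums move up by one.\<close>
    have "comp_set (map length (pieces M (x # xs)))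
        = (if x \<in> M then {1} else {}) \<union> Suc ` comp_set (map length (pieces M xs))"
      using p by (auto simp: comp_set_Cons image_image)
    also have "\<dots> = (if x \<in> M then {1} else {}) \<union> Suc ` ?S"
      unfolding Cons.IH ..
    also have "\<dots> = {k. 1 \<le> k \<and> k < length (x # xs) \<and> (x # xs) ! (k - 1) \<in> M}"
    proof (intro equalityI subsetI)
      fix k assume k: "k \<in> {k. 1 \<le> k \<and> k < length (x # xs) \<and> (x # xs) ! (k - 1) \<in> M}"
      show "k \<in> (if x \<in> M then {1} else {}) \<union> Suc ` ?S"
      proof (cases "k = 1")
        case False
        with k obtain l where "k = Suc l" "1 \<le> l" by (cases k) auto
        with k show ?thesis by (auto simp: nth_Cons')
      qed (use k in auto)
    qed (use Cons in \<open>auto split: if_splits simp: nth_Cons'\<close>)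
    finally show ?thesis .
  qed (simp add: comp_set_def)
qed (simp add: comp_set_def)

lemma finite_fibres_mset: "finite_fibres mset (X :: 'a list set)"
  unfolding finite_fibres_def
proof
  fix m :: "'a multiset"
  have "{w. w \<in> X \<and> mset w = m} \<subseteq> {w. set w \<subseteq> set_mset m \<and> length w = size m}"
    by (auto simp flip: size_mset)
  then show "finite {w. w \<in> X \<and> mset w = m}"
    by (rule finite_subset) (simp add: finite_lists_length_eq)
qed

text \<open>Reading a word along the sorted block turns the comparisons prescribed along arcs into
  the descent set prescribed for the ribbon.\<close>

lemma ribbon_block_comp:
  assumes "finite B"
  shows "ribbon (block_comp M B) = gser (\<lambda>_. 1) (word_mon B) (desc_words M {B})"
proof -
  define xs where "xs = sorted_list_of_set B"
  have xs: "sorted_wrt (<) xs" "set xs = B" "distinct xs" using assms by (auto simp: xs_def)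
  define R where "R = ribbon_words (block_comp M B)"
  have R: "u \<in> R \<longleftrightarrow> length u = length xs \<and> (\<forall>a\<in>set u. a > 0) \<and>
      (\<forall>k. Suc k < length xs \<longrightarrow> (xs ! k \<in> M \<longleftrightarrow> u ! Suc k < u ! k))" for u
  proof -
    have "word_descents u = {k. 1 \<le> k \<and> k < length xs \<and> xs ! (k - 1) \<in> M} \<longleftrightarrow>
        (\<forall>k. Suc k < length xs \<longrightarrow> (xs ! k \<in> M \<longleftrightarrow> u ! Suc k < u ! k))"
      if len: "length u = length xs"
    proof
      assume eq: "word_descents u = {k. 1 \<le> k \<and> k < length xs \<and> xs ! (k - 1) \<in> M}"
      show "\<forall>k. Suc k < length xs \<longrightarrow> (xs ! k \<in> M \<longleftrightarrow> u ! Suc k < u ! k)"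
      proof (intro allI impI)
        fix k assume "Suc k < length xs"
        moreover have "Suc k \<in> word_descents u \<longleftrightarrow>
            Suc k \<in> {k. 1 \<le> k \<and> k < length xs \<and> xs ! (k - 1) \<in> M}"
          using eq by simp
        ultimately show "xs ! k \<in> M \<longleftrightarrow> u ! Suc k < u ! k"
          by (simp add: word_descents_def len)
      qed
    next
      assume *: "\<forall>k. Suc k < length xs \<longrightarrow> (xs ! k \<in> M \<longleftrightarrow> u ! Suc k < u ! k)"
      show "word_descents u = {k. 1 \<le> k \<and> k < length xs \<and> xs ! (k - 1) \<in> M}"
      proof (intro set_eqI)
        fix k
        show "k \<in> word_descents u \<longleftrightarrow> k \<in> {k. 1 \<le> k \<and> k < length xs \<and> xs ! (k - 1) \<in> M}"
          using * by (cases k) (auto simp: word_descents_def len)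
      qed
    qed
    then show ?thesis
      unfolding R_def ribbon_words_def block_comp_def sum_list_pieces comp_set_pieces
      by (auto simp: xs_def)
  qed
  have "inj_on (\<lambda>w. map w xs) (desc_words M {B})"
  proof (rule inj_onI, rule ext)
    fix v w i assume vw: "v \<in> desc_words M {B}" "w \<in> desc_words M {B}" "map v xs = map w xs"
    then have "i \<notin> B \<Longrightarrow> \<not> v i > 0 \<and> \<not> w i > 0" by (simp add: desc_words_def words_def)
    with vw(3) show "v i = w i" using xs(2) by (cases "i \<in> B") auto
  qed
  moreover have "(\<lambda>w. map w xs) ` desc_words M {B} = R"
  proof (intro equalityI subsetI)
    fix u assume u: "u \<in> R"
    \<comment> \<open>The inverse of reading: the letters of \<open>u\<close> are placed along
      \<open>xs\<close>, with 0 outside of \<open>B\<close>.\<close>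
    define w where "w i = (case map_of (zip xs u) i of None \<Rightarrow> 0 | Some a \<Rightarrow> a)" for i
    have len: "length xs = length u" using u by (simp add: R)
    then have w_nth: "w (xs ! k) = u ! k" if "k < length xs" for k
      using that xs(3) by (simp add: w_def map_of_zip_nth)
    have w_out: "w i = 0" if "i \<notin> B" for i
    proof -
      have "map_of (zip xs u) i = None" using that xs(2) len by (simp add: map_of_zip_is_None)
      then show ?thesis by (simp add: w_def)
    qed
    have "w i > 0" if "i \<in> B" for i
    proof -
      obtain k where k: "k < length xs" "i = xs ! k"
        using \<open>i \<in> B\<close> xs(2) by (auto simp: in_set_conv_nth)
      then have "u ! k \<in> set u" using len by simp
      then show ?thesis using k w_nth u by (simp add: R)
    qed
    with w_out have "w \<in> words B" unfolding words_def by (auto intro: ccontr)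
    then have "w \<in> desc_words M {B}"
      using u w_nth arcs_sorted[OF xs(1)] by (auto simp: desc_words_def xs(2) R)
    moreover have "map w xs = u" using w_nth len by (simp add: list_eq_iff_nth_eq)
    ultimately show "u \<in> (\<lambda>w. map w xs) ` desc_words M {B}" by blast
  next
    fix u assume "u \<in> (\<lambda>w. map w xs) ` desc_words M {B}"
    then obtain w where w: "w \<in> desc_words M {B}" "u = map w xs" by blast
    have "xs ! k \<in> M \<longleftrightarrow> w (xs ! Suc k) < w (xs ! k)" if "Suc k < length xs" for k
    proof -
      have "(xs ! k, xs ! Suc k) \<in> arcs {B}"
        using arcs_sorted[OF xs(1)] that by (auto simp: xs(2))
      then show ?thesis using w(1) unfolding desc_words_def by fast
    qed
    moreover have "\<forall>a\<in>set u. a > 0" using w xs(2) by (auto simp: desc_words_def words_def)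
    ultimately show "u \<in> R" using w(2) by (simp add: R)
  qed
  ultimately have "gser (\<lambda>_. 1) mset R
      = gser ((\<lambda>_. 1) \<circ> (\<lambda>w. map w xs)) (mset \<circ> (\<lambda>w. map w xs)) (desc_words M {B}) "
    by (metis gser_reindex)
  also have "\<dots> = gser (\<lambda>_. 1) (word_mon B) (desc_words M {B})"
    using mset_set_set[OF xs(3)] by (intro gser_cong) (auto simp: word_mon_def xs(2))
  finally show ?thesis
    unfolding ribbon_def R_def[symmetric]
    by (subst msum_eq_gser[where \<mu> = mset and c = "\<lambda>_. 1"])
       (auto simp: mcoeff_prod_list_mvar finite_fibres_mset)
qed

section \<open>Products of ribbons over all blocks\<close>

lemma arcs_insert: "arcs (insert B P) = arcs {B} \<union> arcs P"
  by (auto simp: arcs_def)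

lemma arcs_subset: "arcs P \<subseteq> \<Union>P \<times> \<Union>P"
  by (auto simp: arcs_def)

text \<open>No arc joins different blocks, so the conditions on the letters of different blocks are
  independent, and multiplying the series amounts to merging the words.\<close>

lemma prod_blocks:
  assumes "finite P" "finite (\<Union>P)" "disjoint P"
  shows "(\<Prod>B\<in>P. gser (\<lambda>_. 1 :: 'c :: comm_ring_1) (word_mon B) (desc_words M {B}))
       = gser (\<lambda>_. 1) (word_mon (\<Union>P)) (desc_words M P)"
  using assms
proof (induction P rule: finite_induct)
  case empty
  have "desc_words M {} = {\<lambda>_. 0}" by (simp add: desc_words_def arcs_def words_empty)
  then show ?case by (simp add: gser_one word_mon_def)
next
  case (insert B P)
  have fin: "finite B" "finite (\<Union>P)" using insert.prems by auto
  have disj: "B \<inter> \<Union>P = {}"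
    using insert.prems(2) insert.hyps(2) by (force simp: disjoint_def)
  let ?f = "\<lambda>(v, w) i. v i + (w i :: nat)"
  let ?X = "desc_words M {B} \<times> desc_words M P"
  have sub: "?X \<subseteq> words B \<times> words (\<Union>P)" by (auto simp: desc_words_def)
  have bij: "bij_betw ?f (words B \<times> words (\<Union>P)) (words (B \<union> \<Union>P))"
    using disj by (rule bij_betw_words_Un)
  have in_iff: "?f (v, w) \<in> desc_words M (insert B P) \<longleftrightarrow> v \<in> desc_words M {B} \<and> w \<in> desc_words M P"
    if vw: "v \<in> words B" "w \<in> words (\<Union>P)" for v w
  proof -
    have "v i = 0" if "i \<notin> B" for i using vw that by (auto simp: words_def)
    \<comment> \<open>Each summand vanishes at both ends of every arc of the other part, so along an
      arc the merged word compares like a single summand.\<close>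
    then have v: "v i = 0 \<and> v j = 0" if "(i, j) \<in> arcs P" for i j
      using that arcs_subset[of P] disj by blast
    have "w i = 0" if "i \<notin> \<Union>P" for i using vw that by (auto simp: words_def)
    then have w: "w i = 0 \<and> w j = 0" if "(i, j) \<in> arcs {B}" for i j
      using that arcs_subset[of "{B}"] disj by blast
    have "?f (v, w) \<in> words (B \<union> \<Union>P)" using bij vw by (auto simp: bij_betw_def)
    moreover have "(\<forall>(i, j)\<in>arcs P. i \<in> M \<longleftrightarrow> v j + w j < v i + w i) \<longleftrightarrow>
        (\<forall>(i, j)\<in>arcs P. i \<in> M \<longleftrightarrow> w j < w i)"
      by (intro ball_cong refl) (use v in fastforce)
    moreover have "(\<forall>(i, j)\<in>arcs {B}. i \<in> M \<longleftrightarrow> v j + w j < v i + w i) \<longleftrightarrow>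
        (\<forall>(i, j)\<in>arcs {B}. i \<in> M \<longleftrightarrow> v j < v i)"
      by (intro ball_cong refl) (use w in fastforce)
    ultimately show ?thesis
      using vw unfolding desc_words_def arcs_insert[of B P] by (simp add: ball_Un)
  qed
  have "?f ` ?X = desc_words M (insert B P)"
  proof (intro equalityI subsetI)
    fix u assume u: "u \<in> desc_words M (insert B P)"
    then have "u \<in> words (B \<union> \<Union>P)" by (simp add: desc_words_def)
    then obtain v w where "u = ?f (v, w)" "v \<in> words B" "w \<in> words (\<Union>P)"
      using bij unfolding bij_betw_def by blast
    with in_iff[of v w] u show "u \<in> ?f ` ?X" by blast
  qed (use in_iff sub in blast)
  moreover have "inj_on ?f ?X" using bij sub by (auto simp: bij_betw_def intro: inj_on_subset)
  ultimately have "gser (\<lambda>_. 1 :: 'c) (word_mon (B \<union> \<Union>P)) (desc_words M (insert B P))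
      = gser ((\<lambda>_. 1) \<circ> ?f) (word_mon (B \<union> \<Union>P) \<circ> ?f) ?X"
    using gser_reindex[of ?f ?X "\<lambda>_. 1 :: 'c" "word_mon (B \<union> \<Union>P)"] by (simp only:)
  also have "\<dots> = gser (\<lambda>(v, w). 1 * 1) (\<lambda>(v, w). word_mon B v + word_mon (\<Union>P) w) ?X"
    using fin disj by (intro gser_cong) (auto simp: desc_words_def word_mon_Un)
  also have "\<dots> = gser (\<lambda>_. 1) (word_mon B) (desc_words M {B})
      * gser (\<lambda>_. 1) (word_mon (\<Union>P)) (desc_words M P)"
    by (rule gser_times[symmetric])
       (auto simp: desc_words_def intro: finite_fibres_subset[OF finite_fibres_words] fin)
  finally show ?case using insert fin by (simp add: disjoint_def)
qed

section \<open>Weights as products over arcs, and summation over the markings\<close>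

definition arc_prod :: "nat set set \<Rightarrow> (nat \<Rightarrow> nat) \<Rightarrow> edge_poly" where
  "arc_prod P w = (\<Prod>(i, j)\<in>arcs P. arc_wt (j = Suc i) (w j < w i))"

context
  fixes P :: "nat set set" and A :: "nat set"
  assumes fin: "finite A" and part: "partition_on A P"
begin

lemma finite_block: "B \<in> P \<Longrightarrow> finite B"
  using fin part by (metis Union_upper finite_subset partition_on_def)

lemma not_maxima_iff: "i \<in> \<Union>P - maxima P \<longleftrightarrow> (\<exists>B\<in>P. i \<in> B \<and> (\<exists>k\<in>B. i < k))"
proof
  assume i: "i \<in> \<Union>P - maxima P"
  then obtain B where B: "B \<in> P" "i \<in> B" by blast
  then have "i \<noteq> Max B" using i by (auto simp: maxima_def)
  with B finite_block[OF B(1)] have "i < Max B" "Max B \<in> B"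
    by (auto simp: order_less_le intro: Max_in)
  with B show "\<exists>B\<in>P. i \<in> B \<and> (\<exists>k\<in>B. i < k)" by blast
next
  assume "\<exists>B\<in>P. i \<in> B \<and> (\<exists>k\<in>B. i < k)"
  then obtain B k where B: "B \<in> P" "i \<in> B" "k \<in> B" "i < k" by blast
  have "i \<noteq> Max C" if C: "C \<in> P" for C
  proof
    assume eq: "i = Max C"
    have "C \<noteq> {}" using part C by (auto simp: partition_on_def)
    with eq finite_block[OF C] have "i \<in> C" using Max_in by blast
    with B C part have "C = B" by (auto simp: partition_on_def disjoint_def)
    then show False using B eq finite_block[OF B(1)] by (meson Max_ge leD)
  qed
  with B show "i \<in> \<Union>P - maxima P" by (auto simp: maxima_def)
qed

lemma next_in_arc:
  assumes "i \<in> \<Union>P - maxima P"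
  shows "(i, next_in P i) \<in> arcs P"
proof -
  obtain B k where B: "B \<in> P" "i \<in> B" "k \<in> B" "i < k"
    using assms unfolding not_maxima_iff by blast
  have eq: "{j. j > i \<and> (\<exists>B\<in>P. i \<in> B \<and> j \<in> B)} = {j \<in> B. j > i}"
    using B part by (auto simp: partition_on_def disjoint_def)
  have fin: "finite {j \<in> B. j > i}" using finite_block[OF B(1)] by simp
  define m where "m = Min {j \<in> B. j > i}"
  have "m \<in> {j \<in> B. j > i}" unfolding m_def using fin B by (intro Min_in) auto
  moreover have "m \<le> k" if "k \<in> B" "i < k" for k
    unfolding m_def using fin that by (intro Min_le) auto
  then have "\<forall>k\<in>B. k \<le> i \<or> m \<le> k" by (meson not_le)
  ultimately show ?thesis
    unfolding arcs_def next_in_def eq m_def[symmetric] using B by blast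
qed

lemma arc_unique: "(i, j) \<in> arcs P \<Longrightarrow> (i, j') \<in> arcs P \<Longrightarrow> j = j'"
proof -
  assume "(i, j) \<in> arcs P" "(i, j') \<in> arcs P"
  then obtain B B' where B: "B \<in> P" "i \<in> B" "j \<in> B" "i < j" "\<forall>k\<in>B. k \<le> i \<or> j \<le> k"
    and B': "B' \<in> P" "i \<in> B'" "j' \<in> B'" "i < j'" "\<forall>k\<in>B'. k \<le> i \<or> j' \<le> k"
    by (auto simp: arcs_def)
  then have "B = B'" using part unfolding partition_on_def disjoint_def by blast
  then show "j = j'" using B B' by (metis le_antisym not_le)
qed

text \<open>An element that is not a block maximum starts exactly one arc, so markable elements
  correspond to arcs.\<close>

lemma arcs_eq_next_in: "arcs P = (\<lambda>i. (i, next_in P i)) ` (\<Union>P - maxima P)"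
proof (intro equalityI subrelI)
  fix i j assume ij: "(i, j) \<in> arcs P"
  then have "i \<in> \<Union>P - maxima P" unfolding not_maxima_iff by (auto simp: arcs_def)
  with next_in_arc[OF this] arc_unique[OF ij] ij
  show "(i, j) \<in> (\<lambda>i. (i, next_in P i)) ` (\<Union>P - maxima P)" by blast
qed (use next_in_arc in blast)

lemma wt_eq: "wt (P, M) = (\<Prod>(i, j)\<in>arcs P. arc_wt (j = Suc i) (i \<in> M))"
proof -
  let ?N = "\<Union>P - maxima P" and ?f = "\<lambda>i. arc_wt (next_in P i = Suc i) (i \<in> M)"
  have "finite ?N" using fin part by (auto simp: partition_on_def)
  then have finS: "finite (steppers P)" and finJ: "finite (jumpers P)"
    by (auto simp: steppers_def jumpers_def elim: rev_finite_subset)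
  have gt: "next_in P i > i" if "i \<in> ?N" for i
    using next_in_arc[OF that] by (auto simp: arcs_def)
  have N: "?N = steppers P \<union> jumpers P"
    using gt by (fastforce simp: steppers_def jumpers_def)
  have "(\<Prod>(i, j)\<in>arcs P. arc_wt (j = Suc i) (i \<in> M)) = prod ?f ?N"
    unfolding arcs_eq_next_in by (subst prod.reindex) (auto simp: inj_on_def)
  also have "\<dots> = prod ?f (steppers P) * prod ?f (jumpers P)"
    unfolding N by (rule prod.union_disjoint[OF finS finJ]) (auto simp: steppers_def jumpers_def)
  also have "prod ?f (steppers P) = prod ?f (steppers P \<inter> M) * prod ?f (steppers P - M)"
    using finS by (rule prod.Int_Diff)
  also have "prod ?f (jumpers P) = prod ?f (jumpers P \<inter> M) * prod ?f (jumpers P - M)"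
    using finJ by (rule prod.Int_Diff)
  also have "prod ?f (steppers P \<inter> M) = (\<Prod>i\<in>steppers P \<inter> M. lam + rho)"
    by (rule prod.cong) (auto simp: steppers_def arc_wt_def)
  also have "prod ?f (steppers P - M) = (\<Prod>i\<in>steppers P - M. lam_bar + rho_bar)"
    by (rule prod.cong) (auto simp: steppers_def arc_wt_def)
  also have "prod ?f (jumpers P \<inter> M) = (\<Prod>i\<in>jumpers P \<inter> M. lam * rho)"
    by (rule prod.cong) (auto simp: jumpers_def arc_wt_def)
  also have "prod ?f (jumpers P - M) = (\<Prod>i\<in>jumpers P - M. lam_bar * rho_bar)"
    by (rule prod.cong) (auto simp: jumpers_def arc_wt_def)
  finally show ?thesis by (simp add: wt_def sa_def sd_def ja_def jd_def mult_ac)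
qed

text \<open>A word on \<open>A\<close> meets the descent conditions of exactly one marking, the set
  of starts of its descending arcs. Summing over the markings therefore leaves all words, with the
  weight read off from their descents.\<close>

lemma sum_marks:
  "(\<Sum>M\<in>Pow (A - maxima P). mconst (wt (P, M)) * (\<Prod>B\<in>P. ribbon (block_comp M B)))
    = gser (arc_prod P) (word_mon A) (words A)"
proof -
  have A: "\<Union>P = A" "disjoint P" using part by (auto simp: partition_on_def)
  have "finite P" using fin A by (metis finite_UnionD)
  have fst_arcs: "fst ` arcs P = A - maxima P" unfolding arcs_eq_next_in A by force
  have "mconst (wt (P, M)) * (\<Prod>B\<in>P. ribbon (block_comp M B))
      = gser (arc_prod P) (word_mon A) (desc_words M P)" for M
  proof -
    have "(\<Prod>B\<in>P. ribbon (block_comp M B)) = gser (\<lambda>_. 1) (word_mon A) (desc_words M P)"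
      using prod_blocks[of P M, where 'c = edge_poly] \<open>finite P\<close> fin A
      by (simp add: ribbon_block_comp finite_block)
    then have "mconst (wt (P, M)) * (\<Prod>B\<in>P. ribbon (block_comp M B))
        = gser (\<lambda>_. wt (P, M) * 1) (word_mon A) (desc_words M P)"
      unfolding gser_cmult by simp
    also have "\<dots> = gser (arc_prod P) (word_mon A) (desc_words M P)"
      by (rule gser_cong) (auto simp: wt_eq arc_prod_def desc_words_def intro!: prod.cong)
    finally show ?thesis .
  qed
  then have "(\<Sum>M\<in>Pow (A - maxima P). mconst (wt (P, M)) * (\<Prod>B\<in>P. ribbon (block_comp M B)))
      = (\<Sum>M\<in>Pow (A - maxima P). gser (arc_prod P) (word_mon A) (desc_words M P))"
    by simp
  also have "\<dots> = gser (arc_prod P) (word_mon A) (\<Union>M\<in>Pow (A - maxima P). desc_words M P)"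
  proof (rule gser_UN[symmetric])
    show "finite_fibres (word_mon A) (desc_words M P)" for M
      by (rule finite_fibres_subset[OF finite_fibres_words[OF fin]]) (auto simp: desc_words_def A)
    show "desc_words M P \<inter> desc_words M' P = {}"
      if "M \<in> Pow (A - maxima P)" "M' \<in> Pow (A - maxima P)" "M \<noteq> M'" for M M'
    proof -
      have "M = M'" if w: "w \<in> desc_words M P" "w \<in> desc_words M' P" for w
      proof -
        have "i \<in> M \<longleftrightarrow> i \<in> M'" if "(i, j) \<in> arcs P" for i j
          using w that by (auto simp: desc_words_def)
        moreover have "M \<subseteq> fst ` arcs P" "M' \<subseteq> fst ` arcs P"
          unfolding fst_arcs using \<open>M \<in> _\<close> \<open>M' \<in> _\<close> by auto
        ultimately show ?thesis by force
      qed
      with \<open>M \<noteq> M'\<close> show ?thesis by blast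
    qed
  qed (use fin in simp)
  also have "(\<Union>M\<in>Pow (A - maxima P). desc_words M P) = words A"
  proof (intro equalityI subsetI)
    fix w assume w: "w \<in> words A"
    define M where "M = fst ` {(i, j) \<in> arcs P. w j < w i}"
    have "M \<in> Pow (A - maxima P)" unfolding fst_arcs[symmetric] M_def by auto
    moreover have "i \<in> M \<longleftrightarrow> w j < w i" if ij: "(i, j) \<in> arcs P" for i j
    proof
      assume "i \<in> M"
      then obtain j' where "(i, j') \<in> arcs P" "w j' < w i" unfolding M_def by auto
      then show "w j < w i" using arc_unique[OF ij] by blast
    next
      assume "w j < w i"
      with ij show "i \<in> M" unfolding M_def by force
    qed
    then have "w \<in> desc_words M P" using w by (auto simp: desc_words_def A)
    ultimately show "w \<in> (\<Union>M\<in>Pow (A - maxima P). desc_words M P)" by (rule UN_I)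
  qed (auto simp: desc_words_def A)
  finally show ?thesis .
qed

end

text \<open>The ground set is arbitrary because the decomposition below passes to
  subintervals.\<close>

definition interlacing_partitions :: "nat set \<Rightarrow> nat set set set" where
  "interlacing_partitions A = {P. partition_on A P \<and> interlacing P}"

text \<open>Once the marks are summed out, each term belongs to a partition with a letter at every
  element, which is the data encoded by a Motzkin tree.\<close>

lemma sum_mNC:
  "(\<Sum>(P, M) \<in> mNC n. mconst (wt (P, M)) * (\<Prod>B\<in>P. ribbon (block_comp M B)))
    = gser (\<lambda>(P, w). arc_prod P w) (\<lambda>(P, w). word_mon {1..n} w)
        (interlacing_partitions {1..n} \<times> words {1..n})"
proof -
  let ?I = "interlacing_partitions {1..n}" and ?W = "words {1..n}"
  have "?I \<subseteq> Pow (Pow {1..n})" by (auto simp: interlacing_partitions_def partition_on_def)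
  then have fin: "finite ?I" by (rule finite_subset) simp
  have "mNC n = Sigma ?I (\<lambda>P. Pow ({1..n} - maxima P))"
    by (auto simp: mNC_def interlacing_partitions_def)
  then have "(\<Sum>(P, M) \<in> mNC n. mconst (wt (P, M)) * (\<Prod>B\<in>P. ribbon (block_comp M B)))
      = (\<Sum>P\<in>?I. \<Sum>M\<in>Pow ({1..n} - maxima P).
           mconst (wt (P, M)) * (\<Prod>B\<in>P. ribbon (block_comp M B)))"
    using fin by (simp add: sum.Sigma)
  also have "\<dots> = (\<Sum>P\<in>?I. gser (arc_prod P) (word_mon {1..n}) ?W)"
    by (rule sum.cong) (auto simp: interlacing_partitions_def intro!: sum_marks)
  \<comment> \<open>Storing \<open>P\<close> in the index makes the families for different
    \<open>P\<close> disjoint.\<close>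
  also have "\<dots> = (\<Sum>P\<in>?I. gser (\<lambda>(P, w). arc_prod P w) (\<lambda>(P, w). word_mon {1..n} w) (Pair P ` ?W))"
    by (intro sum.cong refl) (subst gser_reindex, auto simp: inj_on_def comp_def)
  also have "\<dots> = gser (\<lambda>(P, w). arc_prod P w) (\<lambda>(P, w). word_mon {1..n} w) (\<Union>P\<in>?I. Pair P ` ?W)"
  proof (rule gser_UN[symmetric, OF fin])
    fix P
    show "finite_fibres (\<lambda>(P, w). word_mon {1..n} w) (Pair P ` ?W)"
      unfolding finite_fibres_def
    proof
      fix m
      have "{i. i \<in> Pair P ` ?W \<and> (case i of (P, w) \<Rightarrow> word_mon {1..n} w) = m}
          \<subseteq> Pair P ` {w. w \<in> ?W \<and> word_mon {1..n} w = m}"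
        by auto
      then show "finite {i. i \<in> Pair P ` ?W \<and> (case i of (P, w) \<Rightarrow> word_mon {1..n} w) = m}"
        using finite_fibres_words[of "{1..n}"] by (elim finite_subset) (simp add: finite_fibres_def)
    qed
  qed auto
  also have "(\<Union>P\<in>?I. Pair P ` ?W) = ?I \<times> ?W" by auto
  finally show ?thesis .
qed

section \<open>Interlacing partitions as Motzkin trees\<close>

lemma interlacing_iff:
  "interlacing P \<longleftrightarrow> noncrossing P \<and> (\<forall>B\<in>P. \<forall>C\<in>P. Min C \<noteq> Suc (Max B))"
  unfolding interlacing_def maxima_def minima_def by (auto simp: image_iff) metis+

lemma noncrossingD:
  assumes "noncrossing P" "B \<in> P" "C \<in> P" "a < b" "b < c" "c < d" "a \<in> B" "c \<in> B" "b \<in> C" "d \<in> C"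
  shows "B = C"
proof (rule ccontr)
  assume "B \<noteq> C"
  then have "\<exists>B\<in>P. \<exists>C\<in>P. B \<noteq> C \<and>
      (\<exists>a b c d. a < b \<and> b < c \<and> c < d \<and> a \<in> B \<and> c \<in> B \<and> b \<in> C \<and> d \<in> C)"
    by (intro bexI[of _ B] bexI[of _ C] conjI exI) (rule assms | assumption)+
  with assms(1) show False unfolding noncrossing_def by (rule notE)
qed

lemma noncrossingI:
  assumes "\<And>B C a b c d. \<lbrakk>B \<in> P; C \<in> P; a < b; b < c; c < d; a \<in> B; c \<in> B; b \<in> C; d \<in> C\<rbrakk> \<Longrightarrow> B = C"
  shows "noncrossing P"
  unfolding noncrossing_def
proof clarify
  fix B C a b c d
  assume "B \<in> P" "C \<in> P" "B \<noteq> C" "a < b" "b < c" "c < d" "a \<in> B" "c \<in> B" "b \<in> C" "d \<in> C"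
  with assms[of B C a b c d] show False by simp
qed

lemma interlacing_partitionsD:
  assumes "P \<in> interlacing_partitions A"
  shows "\<Union>P = A" "B \<in> P \<Longrightarrow> B \<subseteq> A" "B \<in> P \<Longrightarrow> B \<noteq> {}"
    "\<lbrakk>B \<in> P; C \<in> P; x \<in> B; x \<in> C\<rbrakk> \<Longrightarrow> B = C" "noncrossing P"
    "\<lbrakk>B \<in> P; C \<in> P\<rbrakk> \<Longrightarrow> Min C \<noteq> Suc (Max B)"
  using assms unfolding interlacing_partitions_def partition_on_def interlacing_iff disjoint_def
  by blast+

lemma interlacing_partitionsI:
  assumes "\<Union>P = A" "{} \<notin> P" "\<And>B C x. \<lbrakk>B \<in> P; C \<in> P; x \<in> B; x \<in> C\<rbrakk> \<Longrightarrow> B = C" "noncrossing P"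
    "\<And>B C. \<lbrakk>B \<in> P; C \<in> P\<rbrakk> \<Longrightarrow> Min C \<noteq> Suc (Max B)"
  shows "P \<in> interlacing_partitions A"
  using assms unfolding interlacing_partitions_def partition_on_def interlacing_iff disjoint_def
  by blast

section \<open>Decomposition at the first element \<open>s\<close>: \<open>j\<close> follows it in
  its block, \<open>Q\<close> fills the gap, \<open>P\<close> is the rest\<close>

definition glue :: "nat \<Rightarrow> nat \<Rightarrow> nat set set \<Rightarrow> nat set set \<Rightarrow> nat set set" where
  "glue s j Q P = Q \<union> (\<lambda>B. if j \<in> B then insert s B else B) ` P"

context
  fixes s j e :: nat and Q P :: "nat set set"
  assumes j: "s < j" "j < e"
    and Q: "Q \<in> interlacing_partitions {Suc s..<j}"
    and P: "P \<in> interlacing_partitions {j..<e}"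
begin

abbreviation (input) extend :: "nat set \<Rightarrow> nat set" where
  "extend B \<equiv> (if j \<in> B then insert s B else B)"

text \<open>Adjoining \<open>s\<close> alters at most the minimum of a block, and the blocks left
  alone begin beyond \<open>j\<close>. These facts carry the interlacing condition through the
  gluing.\<close>

lemma extend_block:
  assumes "B \<in> P"
  shows "Max (extend B) = Max B" "extend B - {s} = B" "finite B" "j \<le> Max B"
    "Min (extend B) = s \<or> Min (extend B) = Min B \<and> j < Min B"
proof -
  have sub: "B \<subseteq> {j..<e}" using interlacing_partitionsD(2)[OF P assms] .
  have ne: "B \<noteq> {}" using interlacing_partitionsD(3)[OF P assms] .
  show fin: "finite B" using sub finite_subset by blast
  have "Max B \<in> B" "Min B \<in> B" using fin ne by auto
  then have ge: "j \<le> Max B" "j \<le> Min B" using sub by auto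
  have "Max (insert s B) = Max B" "Min (insert s B) = s"
    using fin ne ge j by (simp_all add: max_absorb2 min_absorb1 del: Max_ge_iff Min_ge_iff)
  then show "Max (extend B) = Max B" by simp
  show "j \<le> Max B" by (fact ge)
  show "extend B - {s} = B" using sub j by auto
  show "Min (extend B) = s \<or> Min (extend B) = Min B \<and> j < Min B"
    using \<open>Min B \<in> B\<close> \<open>Min (insert s B) = s\<close> ge by (cases "j \<in> B") (auto simp: le_neq_trans)
qed

lemma glue_blockE:
  assumes "B \<in> glue s j Q P"
  obtains "B \<in> Q" "B \<subseteq> {Suc s..<j}" | B' where "B' \<in> P" "B = extend B'" "B' \<subseteq> {j..<e}"
  using assms interlacing_partitionsD(2)[OF Q] interlacing_partitionsD(2)[OF P]
  unfolding glue_def by blast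

lemma left_range: "B \<in> Q \<Longrightarrow> y \<in> B \<Longrightarrow> s < y \<and> y < j"
  using interlacing_partitionsD(2)[OF Q, of B] by auto

lemma right_range: "B \<in> P \<Longrightarrow> y \<in> extend B \<Longrightarrow> y = s \<or> j \<le> y"
  using interlacing_partitionsD(2)[OF P, of B] by (auto split: if_splits)

text \<open>Blocks of \<open>Q\<close> stay strictly between \<open>s\<close> and \<open>j\<close>,
  and extended blocks of \<open>P\<close> avoid this gap, so mixed pairs neither meet nor cross. For
  two blocks of \<open>P\<close>, the element \<open>s\<close> can be replaced by
  \<open>j\<close>.\<close>

lemma glue_interlacing: "glue s j Q P \<in> interlacing_partitions {s..<e}"
proof (rule interlacing_partitionsI)
  have "\<Union>((\<lambda>B. extend B) ` P) = insert s (\<Union>P)"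
    using interlacing_partitionsD(1)[OF P] j by (auto split: if_splits)
  then show "\<Union>(glue s j Q P) = {s..<e}"
    unfolding glue_def Union_Un_distrib interlacing_partitionsD(1)[OF Q] interlacing_partitionsD(1)[OF P]
    using j by auto
  show "{} \<notin> glue s j Q P"
    using interlacing_partitionsD(3)[OF Q] interlacing_partitionsD(3)[OF P] by (auto simp: glue_def)
next
  fix B C x assume "B \<in> glue s j Q P" "C \<in> glue s j Q P" and x: "x \<in> B" "x \<in> C"
  then show "B = C"
  proof (elim glue_blockE)
    assume "B \<in> Q" "C \<in> Q"
    then show ?thesis using interlacing_partitionsD(4)[OF Q] x by blast
  next
    fix B' C' assume BC: "B' \<in> P" "B = extend B'" "C' \<in> P" "C = extend C'"
      and sub: "B' \<subseteq> {j..<e}" "C' \<subseteq> {j..<e}"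
    have "\<exists>y. y \<in> B' \<and> y \<in> C'"
    proof (cases "x = s")
      case True
      then have "j \<in> B'" "j \<in> C'" using BC x sub j by (auto split: if_splits)
      then show ?thesis by blast
    qed (use BC x in \<open>auto split: if_splits\<close>)
    then show ?thesis using interlacing_partitionsD(4)[OF P] BC by blast
  next
    fix C' assume BC: "B \<in> Q" "C' \<in> P" "C = extend C'"
    have "s < x \<and> x < j" using left_range[OF BC(1) x(1)] .
    moreover have "x = s \<or> j \<le> x" using right_range[OF BC(2)] x(2) BC(3) by simp
    ultimately show ?thesis by simp
  next
    fix B' assume BC: "C \<in> Q" "B' \<in> P" "B = extend B'"
    have "s < x \<and> x < j" using left_range[OF BC(1) x(2)] .
    moreover have "x = s \<or> j \<le> x" using right_range[OF BC(2)] x(1) BC(3) by simp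
    ultimately show ?thesis by simp
  qed
next
  show "noncrossing (glue s j Q P)"
  proof (rule noncrossingI)
    fix B C a b c d
    assume "B \<in> glue s j Q P" "C \<in> glue s j Q P"
      and abcd: "a < b" "b < c" "c < d" "a \<in> B" "c \<in> B" "b \<in> C" "d \<in> C"
    then show "B = C"
    proof (elim glue_blockE)
      assume "B \<in> Q" "C \<in> Q"
      then show ?thesis using noncrossingD[OF interlacing_partitionsD(5)[OF Q]] abcd by blast
    next
      fix B' C' assume BC: "B' \<in> P" "B = extend B'" "C' \<in> P" "C = extend C'"
        and sub: "B' \<subseteq> {j..<e}" "C' \<subseteq> {j..<e}"
      have a: "a = s \<and> j \<in> B' \<or> a \<in> B' \<and> j \<le> a" using BC abcd sub by (auto split: if_splits)
      then have "s < b" using abcd j by auto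
      then have bcd: "b \<in> C'" "c \<in> B'" "d \<in> C'" using BC abcd by (auto split: if_splits)
      \<comment> \<open>If \<open>a\<close> is \<open>s\<close>, it is replaced by \<open>j\<close>,
        which then lies in \<open>B'\<close>; any other \<open>a\<close> is at least
        \<open>j\<close> and stays the same.\<close>
      define a' where "a' = max a j"
      have a': "a' \<in> B'" using a j by (auto simp: a'_def max_def)
      have "B' = C'"
      proof (cases "a' = b")
        case True
        then show ?thesis using a' bcd interlacing_partitionsD(4)[OF P] BC by blast
      next
        case False
        moreover have "j \<le> b" using bcd sub by auto
        ultimately have "a' < b" using abcd by (auto simp: a'_def)
        then show ?thesis
          using noncrossingD[OF interlacing_partitionsD(5)[OF P], of B' C' a' b c d] abcd bcd a' BC
          by blast
      qed
      then show ?thesis using BC by simp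
    next
      fix C' assume BC: "B \<in> Q" "C' \<in> P" "C = extend C'"
      have "s < b \<and> b < j" using left_range[OF BC(1)] abcd by (meson less_trans)
      moreover have "b = s \<or> j \<le> b" using right_range[OF BC(2)] abcd BC(3) by simp
      ultimately show ?thesis by simp
    next
      fix B' assume BC: "C \<in> Q" "B' \<in> P" "B = extend B'"
      have "s < c \<and> c < j" using left_range[OF BC(1)] abcd by (meson less_trans)
      moreover have "c = s \<or> j \<le> c" using right_range[OF BC(2)] abcd BC(3) by simp
      ultimately show ?thesis by simp
    qed
  qed
next
  fix B C assume "B \<in> glue s j Q P" "C \<in> glue s j Q P"
  then show "Min C \<noteq> Suc (Max B)"
  proof (elim glue_blockE)
    assume "B \<in> Q" "C \<in> Q"
    then show ?thesis using interlacing_partitionsD(6)[OF Q] by blast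
  next
    \<comment> \<open>\<open>Suc (Max B)\<close> is above \<open>s\<close> and at most
      \<open>j\<close>, whereas the minimum of \<open>C\<close> is \<open>s\<close> or exceeds
      \<open>j\<close>.\<close>
    fix C' assume B: "B \<in> Q" "B \<subseteq> {Suc s..<j}" and C: "C' \<in> P" "C = extend C'"
    have "finite B" using B finite_subset by blast
    then have "Max B \<in> B" using interlacing_partitionsD(3)[OF Q B(1)] by simp
    then have "s < Max B" "Max B < j" using B(2) by auto
    then show ?thesis using extend_block(5)[OF C(1)] C(2) by auto
  next
    fix B' assume C: "C \<in> Q" "C \<subseteq> {Suc s..<j}" and B: "B' \<in> P" "B = extend B'"
    have "finite C" using C finite_subset by blast
    then have "Min C \<in> C" using interlacing_partitionsD(3)[OF Q C(1)] by simp
    then show ?thesis using extend_block(1,4)[OF B(1)] B(2) C(2) by auto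
  next
    fix B' C' assume BC: "B' \<in> P" "B = extend B'" "C' \<in> P" "C = extend C'"
    then show ?thesis
      using extend_block(1,4)[OF BC(1)] extend_block(5)[OF BC(3)] j
        interlacing_partitionsD(6)[OF P BC(1,3)] by auto
  qed
qed

text \<open>All elements of \<open>P\<close> are at least \<open>j\<close>, so \<open>s\<close> is
  followed by \<open>j\<close> in its block and no other adjacency changes.\<close>

lemma arcs_glue: "arcs (glue s j Q P) = insert (s, j) (arcs Q \<union> arcs P)"
proof (intro equalityI subrelI)
  fix x y assume "(x, y) \<in> arcs (glue s j Q P)"
  then obtain B where B: "B \<in> glue s j Q P" "x < y" "x \<in> B" "y \<in> B" "\<forall>k\<in>B. k \<le> x \<or> y \<le> k"
    by (auto simp: arcs_def)
  from B(1) show "(x, y) \<in> insert (s, j) (arcs Q \<union> arcs P)"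
  proof (cases rule: glue_blockE)
    case 1
    then show ?thesis using B by (auto simp: arcs_def)
  next
    case (2 B')
    have y: "y \<in> B'"
      using B 2 j by (cases "y = s") (auto split: if_splits)
    show ?thesis
    proof (cases "x = s")
      case True
      then have "j \<in> B'" using B 2 j by (auto split: if_splits)
      then have "y \<le> j" using B 2 True j by auto
      then show ?thesis using y 2 True by auto
    next
      case False
      then have "x \<in> B'" using B 2 by (auto split: if_splits)
      then have "(x, y) \<in> arcs P" using B 2 y by (auto simp: arcs_def split: if_splits)
      then show ?thesis by simp
    qed
  qed
next
  fix x y assume "(x, y) \<in> insert (s, j) (arcs Q \<union> arcs P)"
  then consider "(x, y) = (s, j)" | "(x, y) \<in> arcs Q" | "(x, y) \<in> arcs P" by blast
  then show "(x, y) \<in> arcs (glue s j Q P)"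
  proof cases
    case 1
    have "j \<in> \<Union>P" using interlacing_partitionsD(1)[OF P] j by simp
    then obtain B where B: "B \<in> P" "j \<in> B" by blast
    then have "insert s B \<in> glue s j Q P" by (force simp: glue_def)
    moreover have "\<forall>k\<in>insert s B. k \<le> s \<or> j \<le> k"
      using interlacing_partitionsD(2)[OF P B(1)] by auto
    ultimately have "(s, j) \<in> arcs (glue s j Q P)" unfolding arcs_def using B j by blast
    with 1 show ?thesis by simp
  next
    case 2
    then show ?thesis by (auto simp: arcs_def glue_def)
  next
    case 3
    then obtain B where B: "B \<in> P" "x < y" "x \<in> B" "y \<in> B" "\<forall>k\<in>B. k \<le> x \<or> y \<le> k"
      by (auto simp: arcs_def)
    have "B \<subseteq> {j..<e}" using interlacing_partitionsD(2)[OF P B(1)] .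
    then have "s \<le> x" using B j by auto
    then have "extend B \<in> glue s j Q P" "x \<in> extend B" "y \<in> extend B" "\<forall>k\<in>extend B. k \<le> x \<or> y \<le> k"
      using B by (auto simp: glue_def)
    then show ?thesis using B(2) unfolding arcs_def by blast
  qed
qed

text \<open>With \<open>unglue_right\<close>, this recovers both parts from the glued partition once
  \<open>s\<close> and \<open>j\<close> are known. A block coming from \<open>P\<close> has an
  element at or beyond \<open>j\<close> and so never lies inside the gap.\<close>

lemma unglue_left: "Q = {B \<in> glue s j Q P. B \<subseteq> {Suc s..<j}}"
proof (intro equalityI subsetI)
  fix B assume "B \<in> {B \<in> glue s j Q P. B \<subseteq> {Suc s..<j}}"
  then have B: "B \<in> glue s j Q P" "B \<subseteq> {Suc s..<j}" by auto
  from B(1) show "B \<in> Q"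
  proof (cases rule: glue_blockE)
    case (2 B')
    obtain x where x: "x \<in> B'" using interlacing_partitionsD(3)[OF P 2(1)] by blast
    then have "x \<in> B" using 2 by auto
    with x 2(3) B(2) show ?thesis by force
  qed
qed (use interlacing_partitionsD(2)[OF Q] in \<open>auto simp: glue_def\<close>)

lemma unglue_right: "P = (\<lambda>B. B - {s}) ` {B \<in> glue s j Q P. \<not> B \<subseteq> {Suc s..<j}}"
proof (intro equalityI subsetI)
  fix B assume B: "B \<in> P"
  obtain x where "x \<in> B" using interlacing_partitionsD(3)[OF P B] by blast
  then have "x \<in> extend B" "x \<notin> {Suc s..<j}"
    using interlacing_partitionsD(2)[OF P B] by auto
  then have "\<not> extend B \<subseteq> {Suc s..<j}" by blast
  moreover have "extend B \<in> glue s j Q P" using B by (auto simp: glue_def)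
  ultimately show "B \<in> (\<lambda>B. B - {s}) ` {B \<in> glue s j Q P. \<not> B \<subseteq> {Suc s..<j}}"
    using extend_block(2)[OF B] by (intro image_eqI[of _ _ "extend B"]) auto
next
  fix B assume "B \<in> (\<lambda>B. B - {s}) ` {B \<in> glue s j Q P. \<not> B \<subseteq> {Suc s..<j}}"
  then obtain C where C: "C \<in> glue s j Q P" "\<not> C \<subseteq> {Suc s..<j}" "B = C - {s}" by blast
  from C(1) show "B \<in> P"
  proof (cases rule: glue_blockE)
    case (2 B')
    then show ?thesis using C extend_block(2)[of B'] by simp
  qed (use C in simp)
qed

end

lemma interlacing_partitions_empty: "P \<in> interlacing_partitions {} \<longleftrightarrow> P = {}"
proof
  assume P: "P \<in> interlacing_partitions {}"
  show "P = {}" using interlacing_partitionsD(2,3)[OF P] by blast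
qed (auto intro!: interlacing_partitionsI noncrossingI)

lemma interlacing_partitions_single: "P \<in> interlacing_partitions {s} \<longleftrightarrow> P = {{s}}"
proof
  assume P: "P \<in> interlacing_partitions {s}"
  have "B = {s}" if "B \<in> P" for B using interlacing_partitionsD(2,3)[OF P that] by blast
  moreover have "P \<noteq> {}" using interlacing_partitionsD(1)[OF P] by blast
  ultimately show "P = {{s}}" by blast
qed (auto intro!: interlacing_partitionsI noncrossingI)

text \<open>Here \<open>j\<close> is the successor of \<open>s\<close> in its block. It exists,
  since otherwise the block \<open>{s}\<close> would end right before the block of
  \<open>Suc s\<close> begins, against the interlacing condition. Noncrossing separates the blocks
  inside the gap from those beyond \<open>j\<close>.\<close>

lemma glue_exists:
  assumes R: "R \<in> interlacing_partitions {s..<e}" and e: "Suc s < e"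
  obtains j Q P where "s < j" "j < e" "Q \<in> interlacing_partitions {Suc s..<j}"
    "P \<in> interlacing_partitions {j..<e}" "R = glue s j Q P"
proof -
  note R_D = interlacing_partitionsD[OF R]
  have fin: "finite B" if "B \<in> R" for B using R_D(2)[OF that] finite_subset by blast
  have cover: "\<exists>C\<in>R. x \<in> C" if "x \<in> {s..<e}" for x
    using that unfolding R_D(1)[symmetric] by blast
  obtain B where B: "B \<in> R" "s \<in> B" using cover[of s] e by auto
  have "B \<noteq> {s}"
  proof
    assume single: "B = {s}"
    obtain C where C: "C \<in> R" "Suc s \<in> C" using cover[of "Suc s"] e by auto
    have "s \<notin> C" using R_D(4)[OF B(1) C(1) B(2)] C(2) single by auto
    then have "Suc s \<le> x" if "x \<in> C" for x
      using R_D(2)[OF C(1)] that by (metis atLeastLessThan_iff le_neq_implies_less Suc_leI subsetD)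
    then have "Min C = Suc s" using C(2) fin[OF C(1)] by (intro Min_eqI) auto
    then show False using R_D(6)[OF B(1) C(1)] single by simp
  qed
  then have ne: "B - {s} \<noteq> {}" using B by blast
  define j where "j = Min (B - {s})"
  have "j \<in> B - {s}" unfolding j_def using ne fin[OF B(1)] by (intro Min_in) auto
  then have j: "j \<in> B" "j \<noteq> s" by auto
  then have sje: "s < j" "j < e" using R_D(2)[OF B(1)] by auto
  have j_le: "j \<le> x" if "x \<in> B" "x \<noteq> s" for x
    unfolding j_def using that fin[OF B(1)] by (intro Min_le) auto
  have s_notin: "s \<notin> C" "j \<notin> C" if "C \<in> R" "C \<noteq> B" for C
    using R_D(4)[OF B(1) that(1)] B(2) j(1) that(2) by blast+
  have dich: "C \<subseteq> {Suc s..<j} \<or> C \<subseteq> {Suc j..<e}" if C: "C \<in> R" "C \<noteq> B" for C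
  proof (rule ccontr)
    assume "\<not> ?thesis"
    then obtain x y where xy: "x \<in> C" "x \<notin> {Suc s..<j}" "y \<in> C" "y \<notin> {Suc j..<e}" by blast
    have "x \<in> {s..<e}" "y \<in> {s..<e}" using R_D(2)[OF C(1)] xy by auto
    moreover have "x \<noteq> s" "x \<noteq> j" "y \<noteq> s" "y \<noteq> j" using s_notin[OF C] xy by auto
    ultimately have "s < y" "y < j" "j < x" using xy by auto
    then show False
      using noncrossingD[OF R_D(5) B(1) C(1), of s y j x] B(2) j(1) xy C(2) by blast
  qed
  define Q where "Q = {C \<in> R. C \<subseteq> {Suc s..<j}}"
  define P where "P = insert (B - {s}) {C \<in> R. C \<subseteq> {Suc j..<e}}"
  have split: "R = insert B (Q \<union> {C \<in> R. C \<subseteq> {Suc j..<e}})"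
    using dich B by (auto simp: Q_def)
  have B_sub: "B - {s} \<subseteq> {j..<e}" using R_D(2)[OF B(1)] j_le by fastforce
  have "Q \<in> interlacing_partitions {Suc s..<j}"
  proof (rule interlacing_partitionsI)
    show "\<Union>Q = {Suc s..<j}"
    proof (intro equalityI subsetI)
      fix x assume x: "x \<in> {Suc s..<j}"
      then obtain C where C: "C \<in> R" "x \<in> C" using cover[of x] sje by auto
      have "C \<noteq> B" using C(2) x j_le[of x] by auto
      then have "C \<in> Q" using dich[OF C(1)] C x by (auto simp: Q_def)
      then show "x \<in> \<Union>Q" using C by blast
    qed (auto simp: Q_def)
    show "{} \<notin> Q" using R_D(3) by (auto simp: Q_def)
    show "noncrossing Q"
    proof (rule noncrossingI)
      fix C D a b c d
      assume "C \<in> Q" "D \<in> Q" "a < b" "b < c" "c < d" "a \<in> C" "c \<in> C" "b \<in> D" "d \<in> D"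
      then show "C = D" using noncrossingD[OF R_D(5), of C D a b c d] by (simp add: Q_def)
    qed
    show "C = D" if "C \<in> Q" "D \<in> Q" "x \<in> C" "x \<in> D" for C D x
      using R_D(4)[of C D x] that by (simp add: Q_def)
    show "Min D \<noteq> Suc (Max C)" if "C \<in> Q" "D \<in> Q" for C D
      using R_D(6)[of C D] that by (simp add: Q_def)
  qed
  moreover have "P \<in> interlacing_partitions {j..<e}"
  proof (rule interlacing_partitionsI)
    show "\<Union>P = {j..<e}"
    proof (intro equalityI subsetI)
      fix x assume x: "x \<in> {j..<e}"
      then obtain C where C: "C \<in> R" "x \<in> C" using cover[of x] sje by auto
      then show "x \<in> \<Union>P" using dich[OF C(1)] x sje unfolding P_def by (cases "C = B") auto
    next
      fix x assume "x \<in> \<Union>P"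
      then show "x \<in> {j..<e}" using B_sub unfolding P_def by auto
    qed
    show "{} \<notin> P" using R_D(3) ne by (auto simp: P_def)
    have P_R: "\<exists>C'\<in>R. C = C' - {s}" if "C \<in> P" for C
    proof (cases "C = B - {s}")
      case False
      then have "C \<in> R" "C \<subseteq> {Suc j..<e}" using that by (auto simp: P_def)
      moreover from this have "C = C - {s}" using sje by auto
      ultimately show ?thesis by blast
    qed (use B in blast)
    show "C = D" if CD: "C \<in> P" "D \<in> P" "x \<in> C" "x \<in> D" for C D x
    proof -
      obtain C' D' where "C' \<in> R" "C = C' - {s}" "D' \<in> R" "D = D' - {s}"
        using P_R CD(1,2) by meson
      then show ?thesis using R_D(4)[of C' D' x] CD(3,4) by simp
    qed
    show "noncrossing P"
    proof (rule noncrossingI)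
      fix C D a b c d
      assume CD: "C \<in> P" "D \<in> P" and abcd: "a < b" "b < c" "c < d" "a \<in> C" "c \<in> C" "b \<in> D" "d \<in> D"
      obtain C' D' where "C' \<in> R" "C = C' - {s}" "D' \<in> R" "D = D' - {s}"
        using P_R CD by meson
      then show "C = D" using noncrossingD[OF R_D(5), of C' D' a b c d] abcd by simp
    qed
    fix C D assume CD: "C \<in> P" "D \<in> P"
    \<comment> \<open>Removing \<open>s\<close> from \<open>B\<close> keeps its maximum and changes
      its minimum to \<open>j\<close>. The interlacing condition is thus inherited from
      \<open>R\<close>, except at the minimum \<open>j\<close>, which follows no maximum because all
      maxima of \<open>P\<close> are at least \<open>j\<close>.\<close>
    have Max_P: "\<exists>C'\<in>R. Max C' = Max C" "j \<le> Max C" if "C \<in> P" for C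
    proof -
      have "Max (B - {s}) = Max B"
      proof -
        have "Max (insert s (B - {s})) = max s (Max (B - {s}))"
          using fin[OF B(1)] ne by (intro Max_insert) auto
        moreover have "Max (B - {s}) \<in> B - {s}" using fin[OF B(1)] ne by (intro Max_in) auto
        then have "Max (B - {s}) \<in> {j..<e}" using B_sub by blast
        then have "s < Max (B - {s})" using sje by simp
        ultimately show ?thesis using B(2) by (simp add: insert_absorb)
      qed
      then show "\<exists>C'\<in>R. Max C' = Max C" using that B by (auto simp: P_def)
      have "finite C" "C \<noteq> {}" "C \<subseteq> {j..<e}"
        using that fin B(1) ne R_D(3) B_sub by (auto simp: P_def)
      then have "Max C \<in> {j..<e}" using Max_in[of C] by blast
      then show "j \<le> Max C" by simp
    qed
    have Min_P: "D \<in> R \<or> Min D = j" using CD(2) by (auto simp: P_def j_def)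
    show "Min D \<noteq> Suc (Max C)"
      using Min_P
    proof
      assume "D \<in> R"
      then show ?thesis using Max_P(1)[OF CD(1)] R_D(6) by metis
    qed (use Max_P(2)[OF CD(1)] in simp)
  qed
  moreover have "R = glue s j Q P"
  proof -
    have "(\<lambda>B. if j \<in> B then insert s B else B) ` {C \<in> R. C \<subseteq> {Suc j..<e}} = {C \<in> R. C \<subseteq> {Suc j..<e}}"
      by (rule image_cong[where g = id, simplified]) auto
    moreover have "(\<lambda>B. if j \<in> B then insert s B else B) (B - {s}) = B"
      using j B by auto
    ultimately show ?thesis unfolding glue_def P_def image_insert using split by auto
  qed
  ultimately show thesis using that sje by blast
qed

text \<open>The nodes of a tree are numbered in preorder, starting from \<open>s\<close>.\<close>

fun blocks :: "nat \<Rightarrow> 'a tree \<Rightarrow> nat set set" where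
  "blocks s Leaf = {}"
| "blocks s (Node l a r) =
     (if r = Leaf then {{s}}
      else glue s (Suc s + size l) (blocks (Suc s) l) (blocks (Suc s + size l) r))"

text \<open>The labels of a subtree are 0 outside its preorder interval, so the sum picks the
  subtree that contains position \<open>i\<close>.\<close>

fun labels :: "nat \<Rightarrow> nat tree \<Rightarrow> nat \<Rightarrow> nat" where
  "labels s Leaf i = 0"
| "labels s (Node l a r) i =
     (if i = s then a else labels (Suc s) l i + labels (Suc s + size l) r i)"

text \<open>By the Motzkin condition a node without right child is a single element; otherwise the
  right subtree is nonempty, which gives the bound on \<open>j\<close> that gluing requires.\<close>

lemma blocks_interlacing:
  "motzkin t \<Longrightarrow> blocks s t \<in> interlacing_partitions {s..<s + size t}"
proof (induction t arbitrary: s)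
  case (Node l a r)
  show ?case
  proof (cases "r = Leaf")
    case True
    then show ?thesis using Node.prems by (simp add: interlacing_partitions_single)
  next
    case False
    then have "size r > 0" by (simp add: eq_size_0 neq0_conv[symmetric] del: neq0_conv)
    moreover have "blocks (Suc s) l \<in> interlacing_partitions {Suc s..<Suc s + size l}"
      "blocks (Suc s + size l) r
        \<in> interlacing_partitions {Suc s + size l..<Suc s + size l + size r}"
      using Node.IH(1)[of "Suc s"] Node.IH(2)[of "Suc s + size l"] Node.prems by simp_all
    ultimately show ?thesis
      using False glue_interlacing[of s "Suc s + size l" "Suc s + size l + size r"]
      by (simp add: add_ac)
  qed
qed (simp add: interlacing_partitions_empty)

lemma labels_outside: "i \<notin> {s..<s + size t} \<Longrightarrow> labels s t i = 0"
  by (induction t arbitrary: s) auto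

lemma labels_words:
  "\<forall>a\<in>set_tree t. a > 0 \<Longrightarrow> labels s t \<in> words {s..<s + size t}"
proof (induction t arbitrary: s)
  case (Node l a r)
  have l: "labels (Suc s) l i > 0 \<longleftrightarrow> i \<in> {Suc s..<Suc s + size l}" for i
    using Node.IH(1)[of "Suc s"] Node.prems by (auto simp: words_def)
  have r: "labels (Suc s + size l) r i > 0
      \<longleftrightarrow> i \<in> {Suc s + size l..<Suc s + size l + size r}" for i
    using Node.IH(2)[of "Suc s + size l"] Node.prems by (auto simp: words_def)
  show ?case
    unfolding words_def
  proof (intro CollectI allI)
    fix i
    show "labels s (Node l a r) i > 0 \<longleftrightarrow> i \<in> {s..<s + size (Node l a r)}"
      using l[of i] r[of i] Node.prems by (cases "i = s") auto
  qed
qed (simp add: words_def)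

lemma labels_left:
  "i \<in> {Suc s..<Suc s + size l} \<Longrightarrow> labels s (Node l a r) i = labels (Suc s) l i"
  by (simp add: labels_outside)

lemma labels_right:
  "i \<in> {Suc s + size l..<Suc s + size l + size r} \<Longrightarrow>
    labels s (Node l a r) i = labels (Suc s + size l) r i"
  by (simp add: labels_outside)

lemma word_mon_labels: "word_mon {s..<s + size t} (labels s t) = tree_mon t"
proof (induction t arbitrary: s)
  case (Node l a r)
  let ?L = "{Suc s..<Suc s + size l}" and ?R = "{Suc s + size l..<Suc s + size l + size r}"
  have "{s..<s + size (Node l a r)} = insert s (?L \<union> ?R)" by auto
  then have "mset_set {s..<s + size (Node l a r)} = {#s#} + mset_set ?L + mset_set ?R"
    by (simp add: mset_set_Union)
  moreover have "image_mset (labels s (Node l a r)) (mset_set ?L) = tree_mon l"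
    unfolding Node.IH(1)[of "Suc s", symmetric] word_mon_def
    by (intro image_mset_cong) (auto simp: labels_left simp del: labels.simps)
  moreover have "image_mset (labels s (Node l a r)) (mset_set ?R) = tree_mon r"
    unfolding Node.IH(2)[of "Suc s + size l", symmetric] word_mon_def
    by (intro image_mset_cong) (auto simp: labels_right simp del: labels.simps)
  moreover have "labels s (Node l a r) s = a" by simp
  ultimately show ?case by (simp add: word_mon_def del: labels.simps)
qed (simp add: word_mon_def)

lemma arcs_interval:
  "P \<in> interlacing_partitions A \<Longrightarrow> (i, j) \<in> arcs P \<Longrightarrow> i \<in> A \<and> j \<in> A"
  using arcs_subset[of P] interlacing_partitionsD(1)[of P A] by auto

lemma finite_arcs: "P \<in> interlacing_partitions A \<Longrightarrow> finite A \<Longrightarrow> finite (arcs P)"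
  using arcs_subset[of P] interlacing_partitionsD(1)[of P A] by (metis finite_SigmaI finite_subset)

lemma arc_prod_cong:
  "(\<And>i j. (i, j) \<in> arcs P \<Longrightarrow> v i = w i \<and> v j = w j) \<Longrightarrow> arc_prod P v = arc_prod P w"
  unfolding arc_prod_def by (intro prod.cong) fastforce+

text \<open>The arcs are those of the two subtrees and one arc from the root to its right child,
  matching the recursion of \<open>motzkin_wt\<close>.\<close>

lemma arc_prod_blocks: "motzkin t \<Longrightarrow> arc_prod (blocks s t) (labels s t) = motzkin_wt t"
proof (induction t arbitrary: s)
  case (Node l a r)
  show ?case
  proof (cases r)
    case Leaf
    have "arcs {{s}} = {}" by (auto simp: arcs_def)
    with Leaf Node.prems show ?thesis by (simp add: arc_prod_def)
  next
    case (Node rl b rr)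
    define j where "j = Suc s + size l"
    let ?t = "Node l a r" and ?Q = "blocks (Suc s) l" and ?P = "blocks j r"
    have Q: "?Q \<in> interlacing_partitions {Suc s..<j}"
      using blocks_interlacing[of l "Suc s"] Node.prems by (simp add: j_def)
    have P: "?P \<in> interlacing_partitions {j..<j + size r}"
      using blocks_interlacing[of r j] Node.prems by simp
    have "arcs (blocks s ?t) = insert (s, j) (arcs ?Q \<union> arcs ?P)"
      using arcs_glue[OF _ _ Q P] Node by (simp add: j_def)
    moreover have "finite (arcs ?Q)" "finite (arcs ?P)" using Q P by (auto intro: finite_arcs)
    moreover have "(s, j) \<notin> arcs ?Q \<union> arcs ?P"
      using arcs_interval[OF Q, of s j] arcs_interval[OF P, of s j] by (auto simp: j_def)
    moreover have "arcs ?Q \<inter> arcs ?P = {}"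
    proof (intro equals0I, elim IntE)
      fix p assume "p \<in> arcs ?Q" "p \<in> arcs ?P"
      then show False
        using arcs_interval[OF Q, of "fst p" "snd p"] arcs_interval[OF P, of "fst p" "snd p"]
        by simp
    qed
    ultimately have "arc_prod (blocks s ?t) (labels s ?t)
        = arc_wt (j = Suc s) (labels s ?t j < labels s ?t s)
          * (arc_prod ?Q (labels s ?t) * arc_prod ?P (labels s ?t))"
      unfolding arc_prod_def by (simp add: prod.union_disjoint del: labels.simps)
    also have "arc_prod ?Q (labels s ?t) = arc_prod ?Q (labels (Suc s) l)"
      using arcs_interval[OF Q] by (intro arc_prod_cong conjI labels_left) (auto simp: j_def)
    also have "\<dots> = motzkin_wt l" using Node.IH(1) Node.prems by simp
    also have "arc_prod ?P (labels s ?t) = arc_prod ?P (labels j r)"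
      unfolding j_def using arcs_interval[OF P]
      by (intro arc_prod_cong conjI labels_right) (auto simp: j_def)
    also have "\<dots> = motzkin_wt r" using Node.IH(2) Node.prems by simp
    also have "labels s ?t j = b"
      using labels_right[of j s l r a] Node by (simp add: j_def del: labels.simps(2)) simp
    also have "labels s ?t s = a" by simp
    \<comment> \<open>In preorder the left subtree is numbered between the root and its right child,
      so steppers correspond to empty left subtrees.\<close>
    also have "j = Suc s \<longleftrightarrow> l = Leaf" by (simp add: j_def eq_size_0)
    finally show ?thesis using Node by (simp add: mult_ac)
  qed
qed (simp add: arc_prod_def arcs_def)

text \<open>The number \<open>j\<close> of the right child is the end of the unique arc starting at
  \<open>s\<close>. It fixes the size of the left subtree, after which ungluing and restricting the
  labels reduce to the subtrees.\<close>

lemma blocks_labels_inj: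
  "\<lbrakk>motzkin t; motzkin t'; size t = size t'; blocks s t = blocks s t'; labels s t = labels s t'\<rbrakk>
    \<Longrightarrow> t = t'"
proof (induction t arbitrary: s t')
  case Leaf
  then show ?case by (simp add: eq_size_0 eq_commute)
next
  case (Node l a r)
  have "t' \<noteq> Leaf" using Node.prems(3) by auto
  then obtain l' a' r' where t': "t' = Node l' a' r'" by (cases t') simp_all
  have a: "a = a'" using fun_cong[OF Node.prems(5), of s] t' by simp
  show ?case
  proof (cases "size r = 0 \<or> size r' = 0")
    case True
    \<comment> \<open>An empty right subtree makes its tree a single node; equality of sizes then
      does the same for the other tree.\<close>
    then have "size l = 0 \<and> size r = 0 \<and> size l' = 0 \<and> size r' = 0"
      using Node.prems(1,2,3) t' by (auto simp: eq_size_0)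
    then show ?thesis using t' a by (simp add: eq_size_0)
  next
    case False
    define j j' e where "j = Suc s + size l" and "j' = Suc s + size l'" and "e = j + size r"
    have e: "e = j' + size r'" using Node.prems(3) t' by (simp add: e_def j_def j'_def)
    have "0 < size r" "0 < size r'" using False by linarith+
    then have je: "s < j" "j < e" "s < j'" "j' < e"
      using e j_def j'_def e_def by linarith+
    have B: "blocks s (Node l a r) = glue s j (blocks (Suc s) l) (blocks j r)"
      "blocks s t' = glue s j' (blocks (Suc s) l') (blocks j' r')"
      using False t' by (auto simp: j_def j'_def eq_size_0)
    have IP: "blocks (Suc s) l \<in> interlacing_partitions {Suc s..<j}"
      "blocks j r \<in> interlacing_partitions {j..<e}"
      "blocks (Suc s) l' \<in> interlacing_partitions {Suc s..<j'}"
      "blocks j' r' \<in> interlacing_partitions {j'..<e}"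
      using Node.prems(1,2) blocks_interlacing[of l "Suc s"] blocks_interlacing[of l' "Suc s"]
        blocks_interlacing[of r j] blocks_interlacing[of r' j']
      unfolding t' e[symmetric] e_def[symmetric] j_def[symmetric] j'_def[symmetric] by simp_all
    have "(s, j) \<in> arcs (blocks s t')" "(s, j') \<in> arcs (blocks s t')"
      using arcs_glue[OF je(1,2) IP(1,2)] arcs_glue[OF je(3,4) IP(3,4)] Node.prems(4) B by auto
    moreover have "partition_on {s..<s + size t'} (blocks s t')"
      using blocks_interlacing[OF Node.prems(2), of s] by (simp add: interlacing_partitions_def)
    ultimately have jj: "j = j'" using arc_unique[of "{s..<s + size t'}"] by blast
    have sizes: "size l = size l'" "size r = size r'"
      using jj Node.prems(3) t' by (auto simp: j_def j'_def)
    have blocks: "blocks (Suc s) l = blocks (Suc s) l'" "blocks j r = blocks j r'"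
      using unglue_left[OF je(1,2) IP(1,2)] unglue_left[OF je(3,4) IP(3,4)]
        unglue_right[OF je(1,2) IP(1,2)] unglue_right[OF je(3,4) IP(3,4)] B Node.prems(4) jj
      by simp_all
    have "labels (Suc s) l i = labels (Suc s) l' i" for i
    proof (cases "i \<in> {Suc s..<Suc s + size l}")
      case True
      then show ?thesis
        using labels_left[of i s l a r] labels_left[of i s l' a' r'] Node.prems(5) t' sizes by metis
    qed (use sizes labels_outside[of i "Suc s" l] labels_outside[of i "Suc s" l'] in simp)
    then have l: "l = l'"
      using Node.IH(1)[of l' "Suc s"] Node.prems(1,2) t' sizes blocks by (simp add: fun_eq_iff)
    have "labels j r i = labels j r' i" for i
    proof (cases "i \<in> {j..<j + size r}")
      case True
      then show ?thesis
        using labels_right[of i s l r a] labels_right[of i s l' r' a'] Node.prems(5) t' sizes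
        unfolding j_def by metis
    qed (use sizes labels_outside[of i j r] labels_outside[of i j r'] in simp)
    then have "r = r'"
      using Node.IH(2)[of r' j] Node.prems(1,2) t' sizes blocks by (simp add: fun_eq_iff)
    with l a t' show ?thesis by simp
  qed
qed

text \<open>Strong induction along \<open>glue_exists\<close>: the letter at \<open>s\<close>
  becomes the root label, and the word is cut to the two intervals, with 0 elsewhere, for the
  subtrees.\<close>

lemma blocks_labels_surj:
  assumes "P \<in> interlacing_partitions {s..<s + n}" "w \<in> words {s..<s + n}"
  shows "\<exists>t. motzkin t \<and> (\<forall>a\<in>set_tree t. a > 0) \<and> size t = n \<and> blocks s t = P \<and> labels s t = w"
  using assms
proof (induction n arbitrary: s P w rule: less_induct)
  case (less n)
  consider "n = 0" | "n = 1" | "n \<ge> 2" by linarith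
  then show ?case
  proof cases
    case 1
    then have "P = {}" "labels s Leaf = w"
      using less.prems by (auto simp: interlacing_partitions_empty words_empty fun_eq_iff)
    with 1 show ?thesis by (intro exI[of _ Leaf]) simp
  next
    case 2
    then have "P = {{s}}" "w s > 0" "\<And>i. i \<noteq> s \<Longrightarrow> w i = 0"
      using less.prems by (auto simp: interlacing_partitions_single words_def)
    with 2 show ?thesis by (intro exI[of _ "Node Leaf (w s) Leaf"]) (auto simp: fun_eq_iff)
  next
    case 3
    define e where "e = s + n"
    obtain j Q P' where j: "s < j" "j < e" and Q: "Q \<in> interlacing_partitions {Suc s..<j}"
      and P': "P' \<in> interlacing_partitions {j..<e}" and P: "P = glue s j Q P'"
      using glue_exists[of P s e] less.prems(1) 3 by (auto simp: e_def)
    define m k where "m = j - Suc s" and "k = e - j"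
    have mk: "j = Suc s + m" "e = j + k" "m < n" "k < n" "k > 0" "n = Suc (m + k)"
      using j by (auto simp: m_def k_def e_def)
    let ?v = "\<lambda>i. if i \<in> {Suc s..<j} then w i else 0" and ?u = "\<lambda>i. if i \<in> {j..<e} then w i else 0"
    have w: "w i > 0 \<longleftrightarrow> i \<in> {s..<e}" for i using less.prems(2) by (simp add: words_def e_def)
    have v: "?v \<in> words {Suc s..<Suc s + m}" and u: "?u \<in> words {j..<j + k}"
      unfolding words_def mk(1)[symmetric] mk(2)[symmetric] using w j by auto
    obtain l where l: "motzkin l" "\<forall>a\<in>set_tree l. a > 0" "size l = m" "blocks (Suc s) l = Q"
      "labels (Suc s) l = ?v"
      using less.IH[OF \<open>m < n\<close> _ v, of Q] Q mk(1) by auto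
    obtain r where r: "motzkin r" "\<forall>a\<in>set_tree r. a > 0" "size r = k" "blocks j r = P'"
      "labels j r = ?u"
      using less.IH[OF \<open>k < n\<close> _ u, of P'] P' mk(2) by auto
    have "r \<noteq> Leaf" using r(3) \<open>k > 0\<close> by auto
    moreover have "labels s (Node l (w s) r) i = w i" for i
      using l(3,5) r(5) w[of i] j mk(1) by auto
    ultimately show ?thesis
      using l r P mk w[of s] j by (intro exI[of _ "Node l (w s) r"]) auto
  qed
qed

lemma bij_betw_motzkin:
  assumes "n \<ge> 1"
  shows "bij_betw (\<lambda>t. (blocks 1 t, labels 1 t)) {t \<in> motzkin_trees. size t = n}
           (interlacing_partitions {1..n} \<times> words {1..n})"
  unfolding bij_betw_def
proof (intro conjI equalityI subsetI)
  have eq: "{1..n} = {1..<1 + n}" by auto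
  show "inj_on (\<lambda>t. (blocks 1 t, labels 1 t)) {t \<in> motzkin_trees. size t = n}"
    using blocks_labels_inj by (auto simp: inj_on_def motzkin_trees_def)
  show "p \<in> interlacing_partitions {1..n} \<times> words {1..n}"
    if "p \<in> (\<lambda>t. (blocks 1 t, labels 1 t)) ` {t \<in> motzkin_trees. size t = n}" for p
    using that blocks_interlacing[of _ 1] labels_words[of _ 1] unfolding eq
    by (auto simp: motzkin_trees_def)
  fix p assume p: "p \<in> interlacing_partitions {1..n} \<times> words {1..n}"
  then obtain t where "motzkin t" "\<forall>a\<in>set_tree t. a > 0" "size t = n" "blocks 1 t = fst p"
    "labels 1 t = snd p"
    using blocks_labels_surj[of "fst p" 1 n "snd p"] unfolding eq by auto
  then show "p \<in> (\<lambda>t. (blocks 1 t, labels 1 t)) ` {t \<in> motzkin_trees. size t = n}"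
    using assms by (intro image_eqI[of _ _ t]) (auto simp: motzkin_trees_def)
qed

text \<open>The number of nodes is the degree of the monomial, so restricting the size extracts a
  homogeneous part, and an identity of total series passes to each degree.\<close>

lemma mcoeff_gser_size:
  "mcoeff (gser c tree_mon {t \<in> X. size t = n}) m
    = (if size m = n then mcoeff (gser c tree_mon X) m else 0)"
proof (cases "size m = n")
  case True
  then have "{t. t \<in> {t \<in> X. size t = n} \<and> tree_mon t = m} = {t. t \<in> X \<and> tree_mon t = m}"
    by auto
  with True show ?thesis by (simp only: gser.rep_eq refl if_True)
next
  case False
  then have "{t. t \<in> {t \<in> X. size t = n} \<and> tree_mon t = m} = {}" by auto
  with False show ?thesis by (simp only: gser.rep_eq if_False sum.empty)
qed

theorem theorem1p4:
  fixes n :: nat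
  assumes "n \<ge> 1"
  shows "G n = (\<Sum>(P, M) \<in> mNC n. mconst (wt (P, M)) * (\<Prod>B\<in>P. ribbon (block_comp M B)))"
proof -
  let ?f = "\<lambda>t. (blocks 1 t, labels 1 t)"
  have "G n = gser tree_wt tree_mon (labeled_trees n)"
    unfolding G_def
    by (rule msum_eq_gser)
       (simp_all add: tree_term_def mcoeff_mconst_times mcoeff_prod_list_mvar tree_wt_eq)
  \<comment> \<open>The assumption \<open>n \<ge> 1\<close> enters here: it rules out
    \<open>Leaf\<close>, which \<open>trees\<close> excludes.\<close>
  also have "labeled_trees n = {t \<in> trees. size t = n}"
    using assms by (auto simp: labeled_trees_def trees_def)
  also have "gser tree_wt tree_mon \<dots> = gser motzkin_wt tree_mon {t \<in> motzkin_trees. size t = n}"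
    by (rule mfps_eqI) (simp only: mcoeff_gser_size tree_series_eq_motzkin_series)
  also have "\<dots> = gser ((\<lambda>(P, w). arc_prod P w) \<circ> ?f) ((\<lambda>(P, w). word_mon {1..n} w) \<circ> ?f)
      {t \<in> motzkin_trees. size t = n}"
    using word_mon_labels[of 1]
    by (intro gser_cong)
       (auto simp: arc_prod_blocks motzkin_trees_def atLeastLessThanSuc_atLeastAtMost)
  also have "\<dots> = gser (\<lambda>(P, w). arc_prod P w) (\<lambda>(P, w). word_mon {1..n} w)
      (interlacing_partitions {1..n} \<times> words {1..n})"
    using bij_betw_motzkin[OF assms] unfolding bij_betw_def
    by (metis (no_types, lifting) gser_reindex)
  finally show ?thesis unfolding sum_mNC .
qed

end
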